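(* Let $n\ge 3$ and $2\le i\le n-1$, and let $\sigma=s_iw_0\in S_n$, i.e. the permutation whose one-line notation is obtained from $(n,n-1,\dots,1)$ by exchanging the values $i$ and $i+1$. Then $$|C_{s_iw_0}|=\frac{n!}{(n-i)(n-i+1)}+\frac{n!}{i(i+1)}+\frac{n!}{i(n-i)}+\frac{n!}{2}-\frac{n!}{i}-\frac{n!}{n-i}-(i-1)!\,(n-1-i)!.$$
   Context: $w_0\in S_n$ is the longest permutation $w_0(j)=n+1-j$ and $s_i=(i\ i+1)$; $s_iw_0$ denotes the composition $j\mapsto s_i(w_0(j))$. Identify a monotone lattice path from $(0,0)$ to $(n-k,k)$ with the $k$-subset of $[n]$ of positions of its North steps. For $k$-subsets $U=\{u_1<\dots<u_k\}$, $L=\{\ell_1<\dots<\ell_k\}$ of $[n]$ with $u_i\le\ell_i$ for all $i$, the lattice path matroid $M[U,L]$ is the matroid on $[n]$ whose bases are the $k$-sets $\{b_1<\dots<b_k\}$ with $u_i\le b_i\le\ell_i$. $\mathcal{P}_n$ is the poset of all lattice path matroids on $[n]$ ordered by the matroid quotient relation ($M'\le_q M$ iff there is a matroid $N$ on $[n]\sqcup T$ with $M=N\setminus T$, $M'=N/T$). Known: $M[U',L']\le_q M[U,L]$ iff $U'\subseteq U$, $L'\subseteq L$ and the greedy pairing is good, where: $(\ell_i,u_j)$ is a good pair of $M[U,L]$ if $i\le j$ and $u_j-\ell_i\le j-i$; with $U\setminus U'=\{a_1<\dots<a_z\}$, $L\setminus L'=\{b_1<\dots<b_z\}$, the greedy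 pairing $((b_1,a_1),\dots,(b_z,a_z))$ is good if each $(b_r,a_r)$ is a good pair of $M[U\setminus\{a_1,\dots,a_{r-1}\},L\setminus\{b_1,\dots,b_{r-1}\}]$. Covers $M[U\setminus\{u\},L\setminus\{\ell\}]\lessdot M[U,L]$ are labeled $(\ell,u)$. A maximal chain $M[\emptyset,\emptyset]=M_0\lessdot\cdots\lessdot M_n=M[[n],[n]]$ has label sequence $((\ell_1,u_1),\dots,(\ell_n,u_n))$ with $(\ell_i,u_i)=\lambda(M_{i-1}\lessdot M_i)$, and is falling if for each $1\le i<n$ it is not the case that both $\ell_i<\ell_{i+1}$ and $u_i<u_{i+1}$. For $\sigma,\tau\in S_n$, $C_{(\sigma,\tau)}=((\sigma(1),\tau(1)),\dots,(\sigma(n),\tau(n)))$, and $C_\sigma$ is the set of those $C_{(\sigma,\tau)}$, $\tau\in S_n$, that are label sequences of falling maximal chains of $\mathcal{P}_n$. *)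

theory Defs
  imports Complex_Main "HOL-Combinatorics.Permutations"
begin

section \<open>Matroids, minors and quotients\<close>

datatype 'a set_system = Set_System (ground: "'a set") (bases: "'a set set")

definition matroid :: "'a set_system \<Rightarrow> bool" where
  "matroid M \<longleftrightarrow>
     finite (ground M) \<and> (\<forall>B\<in>bases M. B \<subseteq> ground M) \<and> bases M \<noteq> {} \<and>
     (\<forall>B1\<in>bases M. \<forall>B2\<in>bases M. \<forall>x\<in>B1 - B2. \<exists>y\<in>B2 - B1. insert y (B1 - {x}) \<in> bases M)"

definition dual :: "'a set_system \<Rightarrow> 'a set_system" where
  "dual M = Set_System (ground M) ((\<lambda>B. ground M - B) ` bases M)"

text \<open>The bases of \<open>N \ T\<close> are the inclusion-maximal members of \<open>{B - T | B basis of N}\<close>.\<close>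

definition deletion :: "'a set_system \<Rightarrow> 'a set \<Rightarrow> 'a set_system" where
  "deletion N T = Set_System (ground N - T)
     {A \<in> (\<lambda>B. B - T) ` bases N. \<forall>A'\<in>(\<lambda>B. B - T) ` bases N. A \<subseteq> A' \<longrightarrow> A = A'}"

definition contraction :: "'a set_system \<Rightarrow> 'a set \<Rightarrow> 'a set_system" where
  "contraction N T = dual (deletion (dual N) T)"

text \<open>
  \<open>quotient_le M' M\<close> means that \<open>M'\<close> is a quotient of \<open>M\<close>. The element type is fixed to
  \<^typ>\<open>nat\<close>, which is infinite, so that a disjoint set \<open>T\<close> of any finite size is available
  (over a finite type, the existential over \<open>T\<close> would be too restrictive).
\<close>

definition quotient_le :: "nat set_system \<Rightarrow> nat set_system \<Rightarrow> bool" where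
  "quotient_le M' M \<longleftrightarrow>
     (\<exists>N T. matroid N \<and> ground M \<inter> T = {} \<and> ground N = ground M \<union> T \<and>
            M = deletion N T \<and> M' = contraction N T)"

section \<open>Lattice path matroids\<close>

text \<open>
  For finite sets of equal size, \<open>A = {a\<^sub>1 < \<dots> < a\<^sub>k}\<close> and \<open>B = {b\<^sub>1 < \<dots> < b\<^sub>k}\<close>,
  this says \<open>a\<^sub>i \<le> b\<^sub>i\<close> for all \<open>i\<close>; it is false if the sizes differ.
\<close>

definition comp_le :: "nat set \<Rightarrow> nat set \<Rightarrow> bool" where
  "comp_le A B \<longleftrightarrow> list_all2 (\<le>) (sorted_list_of_set A) (sorted_list_of_set B)"

text \<open>\<open>lpm n U L\<close> is \<open>M[U,L]\<close>; it is meaningful for \<open>(U, L) \<in> path_pairs n\<close>.\<close>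

definition path_pairs :: "nat \<Rightarrow> (nat set \<times> nat set) set" where
  "path_pairs n = {(U, L). U \<subseteq> {1..n} \<and> L \<subseteq> {1..n} \<and> comp_le U L}"

definition lpm :: "nat \<Rightarrow> nat set \<Rightarrow> nat set \<Rightarrow> nat set_system" where
  "lpm n U L = Set_System {1..n} {B. B \<subseteq> {1..n} \<and> comp_le U B \<and> comp_le B L}"

definition lpms :: "nat \<Rightarrow> nat set_system set" where
  "lpms n = {lpm n U L | U L. (U, L) \<in> path_pairs n}"

section \<open>Labeled covers and falling maximal chains\<close>

definition lpm_less :: "nat \<Rightarrow> nat set_system \<Rightarrow> nat set_system \<Rightarrow> bool" where
  "lpm_less n M' M \<longleftrightarrow> M' \<in> lpms n \<and> M \<in> lpms n \<and> quotient_le M' M \<and> M' \<noteq> M"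

definition lpm_cover :: "nat \<Rightarrow> nat set_system \<Rightarrow> nat set_system \<Rightarrow> bool" where
  "lpm_cover n M' M \<longleftrightarrow> lpm_less n M' M \<and> (\<nexists>K. lpm_less n M' K \<and> lpm_less n K M)"

text \<open>
  The labeling \<open>\<lambda>\<close> as a relation: \<open>p = (\<ell>, u)\<close> is the label of the cover of \<open>M'\<close> by \<open>M\<close>.
  There is at most one such \<open>p\<close>, because \<open>M[U,L]\<close> determines \<open>U\<close> and \<open>L\<close> (its least and
  greatest basis with respect to \<^const>\<open>comp_le\<close>).
\<close>

definition cover_label ::
    "nat \<Rightarrow> nat set_system \<Rightarrow> nat set_system \<Rightarrow> nat \<times> nat \<Rightarrow> bool" where
  "cover_label n M' M p \<longleftrightarrow> lpm_cover n M' M \<and>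
     (\<exists>U L l u. p = (l, u) \<and> u \<in> U \<and> l \<in> L \<and>
        (U, L) \<in> path_pairs n \<and> (U - {u}, L - {l}) \<in> path_pairs n \<and>
        M = lpm n U L \<and> M' = lpm n (U - {u}) (L - {l}))"

definition maximal_chain :: "nat \<Rightarrow> nat set_system list \<Rightarrow> bool" where
  "maximal_chain n Ms \<longleftrightarrow> length Ms = n + 1 \<and>
     Ms ! 0 = lpm n {} {} \<and> Ms ! n = lpm n {1..n} {1..n} \<and>
     (\<forall>i<n. lpm_cover n (Ms ! i) (Ms ! (i + 1)))"

definition label_sequence :: "nat \<Rightarrow> nat set_system list \<Rightarrow> (nat \<times> nat) list \<Rightarrow> bool" where
  "label_sequence n Ms ps \<longleftrightarrow> length ps = n \<and>
     (\<forall>i<n. cover_label n (Ms ! i) (Ms ! (i + 1)) (ps ! i))"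

definition falling :: "(nat \<times> nat) list \<Rightarrow> bool" where
  "falling ps \<longleftrightarrow> (\<forall>i. i + 1 < length ps \<longrightarrow>
     \<not> (fst (ps ! i) < fst (ps ! (i + 1)) \<and> snd (ps ! i) < snd (ps ! (i + 1))))"

definition C_pair :: "nat \<Rightarrow> (nat \<Rightarrow> nat) \<Rightarrow> (nat \<Rightarrow> nat) \<Rightarrow> (nat \<times> nat) list" where
  "C_pair n \<sigma> \<tau> = map (\<lambda>j. (\<sigma> j, \<tau> j)) [1..<n + 1]"

definition C_set :: "nat \<Rightarrow> (nat \<Rightarrow> nat) \<Rightarrow> (nat \<times> nat) list set" where
  "C_set n \<sigma> = {C_pair n \<sigma> \<tau> | \<tau>. \<tau> permutes {1..n} \<and>
     (\<exists>Ms. maximal_chain n Ms \<and> label_sequence n Ms (C_pair n \<sigma> \<tau>) \<and>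
           falling (C_pair n \<sigma> \<tau>))}"

definition w0 :: "nat \<Rightarrow> nat \<Rightarrow> nat" where
  "w0 n j = (if j \<in> {1..n} then n + 1 - j else j)"

end

theory Submission
  imports Defs
begin

text \<open>
  Adding labels one at a time, \<open>C_{(\<sigma>,\<tau>)}\<close> is the label sequence of a chain iff each
  \<open>M[\<tau>{1..k}, \<sigma>{1..k}]\<close> exists and is a quotient of its successor. For \<open>\<sigma> = s\<^sub>i w\<^sub>0\<close> the lower paths
  \<open>\<sigma>{1..k}\<close> are the trivial ones \<open>{n+1-k..n}\<close>, except at \<open>k = m = n - i\<close>, where the lower path only
  excludes the single basis \<open>H = {i+1..n}\<close>. Hence only the steps at \<open>m\<close> and \<open>m + 1\<close> impose conditions:
  some later value exceeds \<open>\<tau>(m)\<close>, and some earlier value is below \<open>\<tau>(m+1)\<close>; falling means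
  \<open>\<tau>(m) > \<tau>(m+1)\<close>. Inclusion-exclusion over the failure of the first two conditions leaves
  events saying that an entry is extremal among given positions, which are counted by symmetry, up to the
  \<open>(m-1)! (i-1)!\<close> permutations whose last values, \<open>\<tau>(m)\<close>, \<open>\<tau>(m+1)\<close> and first values increase in this order.
\<close>

section \<open>Matroids and quotients\<close>

text \<open>A quotient is defined through an unspecified matroid N, so the two directions of each
  step need different means. To establish a quotient, one new element is enough: the bases of N are
  those of M together with those of M' enlarged by it. When the lower path is trivial, only prefix
  counts are bounded, so N is given by capacities on a chain of sets, and exchange can be checked at
  the largest tight set. At the exceptional lower path one basis must be taken out of N (H at step
  m, H with the new element at step m + 1). Exchange survives if a substitute for the lost basis is
  always available, which is what the two conditions on \<open>\<tau>\<close> guarantee. To refute a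
  quotient, containment suffices: every basis of M' lies in a basis of M, and every basis of M
  contains one of M'. The witnesses are H without the newest element of the upper path at step m,
  and H with it at step m + 1. In the count, both failing conditions involve the comparison of the
  entries at m and m + 1; dropping it separates the positions into two disjoint groups, at the price
  of a correction term.\<close>

lemma bases_deletion:
  "bases (deletion N T) =
     {A \<in> (\<lambda>B. B - T) ` bases N. \<forall>A'\<in>(\<lambda>B. B - T) ` bases N. A \<subseteq> A' \<longrightarrow> A = A'}"
  by (simp add: deletion_def)

text \<open>Complementation within \<open>ground N - T\<close> reverses inclusion, so the maximal
  sets of the dual become minimal ones. Deletion and contraction thus select opposite ends of the
  same family of traces \<open>B - T\<close>.\<close>

lemma bases_contraction:
  assumes "\<And>B. B \<in> bases N \<Longrightarrow> B \<subseteq> ground N"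
  shows "bases (contraction N T) =
     {A \<in> (\<lambda>B. B - T) ` bases N. \<forall>A'\<in>(\<lambda>B. B - T) ` bases N. A' \<subseteq> A \<longrightarrow> A = A'}"
proof -
  define F where "F = (\<lambda>B. B - T) ` bases N"
  define E where "E = ground N - T"
  have sub: "A \<subseteq> E" if "A \<in> F" for A
    using that assms by (auto simp: F_def E_def)
  have "(\<lambda>B. ground N - B - T) ` bases N = (\<lambda>A. E - A) ` F"
    unfolding F_def E_def image_image by (intro image_cong) auto
  then have "bases (contraction N T) =
      (\<lambda>A. E - A) ` {A \<in> (\<lambda>A. E - A) ` F. \<forall>A'\<in>(\<lambda>A. E - A) ` F. A \<subseteq> A' \<longrightarrow> A = A'}"
    by (simp add: contraction_def dual_def deletion_def image_image E_def)
  also have "\<dots> = {A \<in> F. \<forall>A'\<in>F. A' \<subseteq> A \<longrightarrow> A = A'}"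
  proof (intro set_eqI iffI)
    fix A
    assume "A \<in> (\<lambda>A. E - A) ` {A \<in> (\<lambda>A. E - A) ` F. \<forall>A'\<in>(\<lambda>A. E - A) ` F. A \<subseteq> A' \<longrightarrow> A = A'}"
    then obtain B where B: "B \<in> F" "A = E - (E - B)" 
      and max: "\<forall>A'\<in>F. E - B \<subseteq> E - A' \<longrightarrow> E - B = E - A'"
      by auto
    from B sub have AB: "A = B" by blast
    have "A = A'" if "A' \<in> F" "A' \<subseteq> A" for A'
    proof -
      have "E - B = E - A'" using max that unfolding AB by blast
      then show ?thesis using sub[OF that(1)] sub[OF B(1)] unfolding AB by blast
    qed
    then show "A \<in> {A \<in> F. \<forall>A'\<in>F. A' \<subseteq> A \<longrightarrow> A = A'}"
      using B(1) unfolding AB by blast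
  next
    fix A
    assume "A \<in> {A \<in> F. \<forall>A'\<in>F. A' \<subseteq> A \<longrightarrow> A = A'}"
    then have A: "A \<in> F" and min: "\<And>A'. A' \<in> F \<Longrightarrow> A' \<subseteq> A \<Longrightarrow> A = A'"
      by auto
    have eq: "A = E - (E - A)"
      using sub[OF A] by blast
    have "E - A = E - A'" if "A' \<in> F" "E - A \<subseteq> E - A'" for A'
    proof -
      have "A' \<subseteq> A" using that(2) sub[OF that(1)] by blast
      with min[OF that(1)] show ?thesis by simp
    qed
    then have "E - A \<in> {A \<in> (\<lambda>A. E - A) ` F. \<forall>A'\<in>(\<lambda>A. E - A) ` F. A \<subseteq> A' \<longrightarrow> A = A'}"
      using A by blast
    then show "A \<in> (\<lambda>A. E - A) ` {A \<in> (\<lambda>A. E - A) ` F. \<forall>A'\<in>(\<lambda>A. E - A) ` F. A \<subseteq> A' \<longrightarrow> A = A'}"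
      using eq by (rule rev_image_eqI)
  qed
  finally show ?thesis
    unfolding F_def .
qed

lemma quotient_le_minors:
  assumes "quotient_le M' M"
  obtains F where "finite F"
    "bases M = {A \<in> F. \<forall>A'\<in>F. A \<subseteq> A' \<longrightarrow> A = A'}"
    "bases M' = {A \<in> F. \<forall>A'\<in>F. A' \<subseteq> A \<longrightarrow> A = A'}"
    "ground M' = ground M"
proof -
  obtain N T where N: "matroid N" "ground M \<inter> T = {}" "ground N = ground M \<union> T"
    and M: "M = deletion N T" and M': "M' = contraction N T"
    using assms unfolding quotient_le_def by blast
  have sub: "\<And>B. B \<in> bases N \<Longrightarrow> B \<subseteq> ground N" and fin: "finite (ground N)"
    using N(1) by (auto simp: matroid_def)
  have "finite (bases N)"
    using sub fin by (intro finite_subset[of "bases N" "Pow (ground N)"]) auto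
  then show thesis
    using that[of "(\<lambda>B. B - T) ` bases N"] bases_deletion[of N T] bases_contraction[OF sub, of T]
    unfolding M M' by (simp add: contraction_def dual_def deletion_def)
qed

text \<open>In a finite family every member lies below a maximal one. This fact and its mirror image
  below are the tests by which quotients are refuted.\<close>

lemma quotient_le_basis_extends:
  assumes "quotient_le M' M" "B' \<in> bases M'"
  shows "\<exists>B\<in>bases M. B' \<subseteq> B"
proof -
  obtain F where F: "finite F" "bases M = {A \<in> F. \<forall>A'\<in>F. A \<subseteq> A' \<longrightarrow> A = A'}"
    "bases M' = {A \<in> F. \<forall>A'\<in>F. A' \<subseteq> A \<longrightarrow> A = A'}" "ground M' = ground M"
    by (rule quotient_le_minors[OF assms(1)])
  have "B' \<in> F" using assms F by auto
  from finite_has_maximal2[OF F(1) this] show ?thesis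
    unfolding F(2) by blast
qed

lemma quotient_le_basis_restricts:
  assumes "quotient_le M' M" "B \<in> bases M"
  shows "\<exists>B'\<in>bases M'. B' \<subseteq> B"
proof -
  obtain F where F: "finite F" "bases M = {A \<in> F. \<forall>A'\<in>F. A \<subseteq> A' \<longrightarrow> A = A'}"
    "bases M' = {A \<in> F. \<forall>A'\<in>F. A' \<subseteq> A \<longrightarrow> A = A'}" "ground M' = ground M"
    by (rule quotient_le_minors[OF assms(1)])
  have "B \<in> F" using assms F by auto
  from finite_has_minimal2[OF F(1) this] show ?thesis
    unfolding F(3) by blast
qed

text \<open>Every trace lies between a minimal and a maximal one; equal sizes make all three
  coincide. Hence a proper quotient has smaller rank.\<close>

lemma quotient_le_rank_eq:
  assumes "quotient_le M' M"
    and "\<And>B. B \<in> bases M \<Longrightarrow> finite B \<and> card B = r" 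
    and "\<And>B. B \<in> bases M' \<Longrightarrow> card B = r"
  shows "M' = M"
proof -
  obtain F where F: "finite F" "bases M = {A \<in> F. \<forall>A'\<in>F. A \<subseteq> A' \<longrightarrow> A = A'}"
    "bases M' = {A \<in> F. \<forall>A'\<in>F. A' \<subseteq> A \<longrightarrow> A = A'}" "ground M' = ground M"
    by (rule quotient_le_minors[OF assms(1)])
  have "A \<in> bases M \<and> A \<in> bases M'" if A: "A \<in> F" for A
  proof -
    obtain A1 where A1: "A1 \<in> bases M'" "A1 \<subseteq> A"
      using finite_has_minimal2[OF F(1) A] unfolding F(3) by blast
    obtain A2 where A2: "A2 \<in> bases M" "A \<subseteq> A2"
      using finite_has_maximal2[OF F(1) A] unfolding F(2) by blast
    have "A1 = A2"
      using A1 A2 assms(2)[of A2] assms(3)[of A1] by (metis card_subset_eq subset_trans)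
    then show ?thesis
      using A1 A2 by auto
  qed
  then have "bases M = bases M'"
    using F(2,3) by blast
  with F(4) show ?thesis
    by (simp add: set_system.expand)
qed

section \<open>Basis exchange and constructions of matroids\<close>

lemma matroid_exchange:
  assumes "matroid N" "B1 \<in> bases N" "B2 \<in> bases N" "x \<in> B1" "x \<notin> B2"
  obtains y where "y \<in> B2" "y \<notin> B1" "insert y (B1 - {x}) \<in> bases N"
  using assms unfolding matroid_def by (metis DiffE DiffI)

text \<open>Among the bases containing \<open>e\<close>, take one with fewest elements outside
  \<open>B\<close>: any element outside \<open>insert e B\<close> could still be exchanged for one
  of \<open>B\<close>.\<close>

lemma matroid_basis_near:
  assumes "matroid N" "B \<in> bases N" "B0 \<in> bases N" "e \<in> B0"
  obtains B' where "B' \<in> bases N" "e \<in> B'" "B' \<subseteq> insert e B"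
proof -
  define \<mu> where "\<mu> C = card (C - B)" for C
  have fin: "finite C" if "C \<in> bases N" for C
    using assms(1) that unfolding matroid_def by (metis finite_subset)
  define B' where "B' = arg_min \<mu> (\<lambda>C. C \<in> bases N \<and> e \<in> C)"
  have B': "B' \<in> bases N" "e \<in> B'" and min: "\<And>C. C \<in> bases N \<Longrightarrow> e \<in> C \<Longrightarrow> \<mu> B' \<le> \<mu> C"
    using arg_min_nat_lemma[of "\<lambda>C. C \<in> bases N \<and> e \<in> C" B0 \<mu>] assms(3,4) B'_def by auto
  have "B' \<subseteq> insert e B"
  proof
    fix x assume x: "x \<in> B'"
    show "x \<in> insert e B"
    proof (rule ccontr)
      assume nx: "x \<notin> insert e B"
      then obtain y where y: "y \<in> B" "y \<notin> B'" "insert y (B' - {x}) \<in> bases N"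
        using matroid_exchange[OF assms(1) B'(1) assms(2) x] by blast
      have "insert y (B' - {x}) - B = (B' - B) - {x}"
        using y by auto
      moreover have "card ((B' - B) - {x}) < card (B' - B)"
        using x nx fin[OF B'(1)] by (intro psubset_card_mono) auto
      moreover have "e \<in> insert y (B' - {x})"
        using B' nx by auto
      ultimately show False
        using min[OF y(3)] by (simp add: \<mu>_def)
    qed
  qed
  with B' show thesis
    using that by blast
qed

text \<open>For \<open>T = {e}\<close> the traces are \<open>Bs \<union> Bs'\<close>. Exchange in
  the large matroid places each member of \<open>Bs'\<close> inside one of \<open>Bs\<close> and
  finds one of \<open>Bs'\<close> inside each member of \<open>Bs\<close>; as the sizes differ by
  one, these are exactly the minimal and the maximal traces.\<close>

lemma quotient_le_extension:
  assumes N: "matroid (Set_System (insert e E) (Bs \<union> insert e ` Bs'))" and e: "e \<notin> E"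
    and Bs: "\<And>B. B \<in> Bs \<Longrightarrow> B \<subseteq> E \<and> card B = Suc r" 
    and Bs': "\<And>B. B \<in> Bs' \<Longrightarrow> B \<subseteq> E \<and> card B = r"
    and ne: "Bs \<noteq> {}" "Bs' \<noteq> {}"
  shows "quotient_le (Set_System E Bs') (Set_System E Bs)"
proof -
  define N where "N = Set_System (insert e E) (Bs \<union> insert e ` Bs')"
  have mN: "matroid N" using N N_def by simp
  have bN: "bases N = Bs \<union> insert e ` Bs'" and gN: "ground N = insert e E"
    by (simp_all add: N_def)
  have finE: "finite E"
    using mN gN by (auto simp: matroid_def)
  have img: "(\<lambda>B. B - {e}) ` bases N = Bs \<union> Bs'"
  proof -
    have "(\<lambda>B. B - {e}) ` Bs = id ` Bs" using e Bs by (intro image_cong) auto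
    moreover have "(\<lambda>B. B - {e}) ` insert e ` Bs' = id ` Bs'"
      unfolding image_image using e Bs' by (intro image_cong) auto
    ultimately show ?thesis by (simp add: bN image_Un)
  qed
  have ext: "\<exists>B\<in>Bs. B' \<subseteq> B" if B': "B' \<in> Bs'" for B'
  proof -
    obtain B where B: "B \<in> Bs" using ne by auto
    have "e \<notin> B'" "e \<notin> B" using e Bs' Bs B' B by blast+
    then obtain y where y: "y \<in> B" "insert y (insert e B' - {e}) \<in> bases N"
      using matroid_exchange[OF mN, of "insert e B'" B e] B B' bN by blast
    moreover have "e \<notin> insert y (insert e B' - {e})"
      using y \<open>e \<notin> B\<close> by auto
    ultimately have "insert y (insert e B' - {e}) \<in> Bs"
      unfolding bN by blast
    then show ?thesis
      using \<open>e \<notin> B'\<close> by (intro bexI[of _ "insert y (insert e B' - {e})"]) auto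
  qed
  have restr: "\<exists>B'\<in>Bs'. B' \<subseteq> B" if B: "B \<in> Bs" for B
  proof -
    obtain B0 where B0: "B0 \<in> Bs'" using ne by auto
    have "insert e B0 \<in> bases N" "B \<in> bases N" using B0 B bN by auto
    then obtain B1 where B1: "B1 \<in> bases N" "e \<in> B1" "B1 \<subseteq> insert e B"
      using matroid_basis_near[OF mN, of B "insert e B0" e] by blast
    then obtain B' where "B' \<in> Bs'" "B1 = insert e B'"
      using e Bs unfolding bN by blast
    then show ?thesis
      using B1 e Bs' by blast
  qed
  have fin: "finite B" if "B \<in> Bs \<union> Bs'" for B
    using that Bs Bs' finite_subset[OF _ finE, of B] by auto
  have no: "\<not> B \<subseteq> B'" if "B \<in> Bs" "B' \<in> Bs'" for B B'
    using card_mono[of B' B] fin[of B'] Bs[of B] Bs'[of B'] that by auto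
  have anti: "B = B'" if "B \<subseteq> B'" "B \<in> Bs \<and> B' \<in> Bs \<or> B \<in> Bs' \<and> B' \<in> Bs'" for B B'
    using that(2) Bs[of B] Bs[of B'] Bs'[of B] Bs'[of B'] fin[of B'] card_subset_eq[OF _ that(1)] by auto
  have max: "Bs = {A \<in> Bs \<union> Bs'. \<forall>A'\<in>Bs \<union> Bs'. A \<subseteq> A' \<longrightarrow> A = A'}"
  proof (intro set_eqI iffI)
    fix A assume A: "A \<in> Bs"
    have "A = A'" if "A' \<in> Bs \<union> Bs'" "A \<subseteq> A'" for A'
      using A that no[of A A'] anti[of A A'] by auto
    with A show "A \<in> {A \<in> Bs \<union> Bs'. \<forall>A'\<in>Bs \<union> Bs'. A \<subseteq> A' \<longrightarrow> A = A'}"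
      by blast
  next
    fix A assume A: "A \<in> {A \<in> Bs \<union> Bs'. \<forall>A'\<in>Bs \<union> Bs'. A \<subseteq> A' \<longrightarrow> A = A'}"
    then show "A \<in> Bs" using ext[of A] by blast
  qed
  have min: "Bs' = {A \<in> Bs \<union> Bs'. \<forall>A'\<in>Bs \<union> Bs'. A' \<subseteq> A \<longrightarrow> A = A'}"
  proof (intro set_eqI iffI)
    fix A assume A: "A \<in> Bs'"
    have "A = A'" if "A' \<in> Bs \<union> Bs'" "A' \<subseteq> A" for A'
      using A that no[of A' A] anti[of A' A] by auto
    with A show "A \<in> {A \<in> Bs \<union> Bs'. \<forall>A'\<in>Bs \<union> Bs'. A' \<subseteq> A \<longrightarrow> A = A'}"
      by blast
  next
    fix A assume A: "A \<in> {A \<in> Bs \<union> Bs'. \<forall>A'\<in>Bs \<union> Bs'. A' \<subseteq> A \<longrightarrow> A = A'}"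
    then show "A \<in> Bs'" using restr[of A] by blast
  qed
  have sub: "\<And>B. B \<in> bases N \<Longrightarrow> B \<subseteq> ground N"
    using mN by (auto simp: matroid_def)
  have "Set_System E Bs = deletion N {e}"
  proof (rule set_system.expand, intro conjI)
    show "ground (Set_System E Bs) = ground (deletion N {e})"
      using e by (simp add: deletion_def gN)
    show "bases (Set_System E Bs) = bases (deletion N {e})"
      unfolding bases_deletion img max[symmetric] by simp
  qed
  moreover have "Set_System E Bs' = contraction N {e}"
  proof (rule set_system.expand, intro conjI)
    show "ground (Set_System E Bs') = ground (contraction N {e})"
      using e by (simp add: contraction_def dual_def deletion_def gN)
    show "bases (Set_System E Bs') = bases (contraction N {e})"
      using bases_contraction[of N "{e}"] sub unfolding img min[symmetric] by simp
  qed
  moreover have "E \<inter> {e} = {}" "ground N = E \<union> {e}" using e gN by simp_all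
  ultimately show ?thesis
    unfolding quotient_le_def using mN by (metis set_system.sel(1))
qed

text \<open>An exchange is spoiled only if its result is \<open>H\<close> itself, so that
  \<open>B1\<close> is \<open>H\<close> with some \<open>y\<close> replaced by \<open>x\<close>.
  Since \<open>B2\<close> differs from \<open>H\<close> and has the same size, it contains some
  \<open>z\<close> outside \<open>H\<close>, and \<open>swap\<close> says that \<open>z\<close> can
  replace \<open>y\<close> instead.\<close>

lemma matroid_remove_basis:
  assumes N: "matroid (Set_System E Bs)" and ne: "Bs - {H} \<noteq> {}"
    and card: "\<And>B. B \<in> Bs \<Longrightarrow> card B = card H" and H: "finite H"
    and swap: "\<And>x y z B. \<lbrakk>y \<in> H; x \<notin> H; z \<notin> H; insert x (H - {y}) \<in> Bs; B \<in> Bs; z \<in> B; x \<notin> B\<rbrakk>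
      \<Longrightarrow> insert z (H - {y}) \<in> Bs"
  shows "matroid (Set_System E (Bs - {H}))"
proof -
  have "\<exists>z\<in>B2 - B1. insert z (B1 - {x}) \<in> Bs - {H}"
    if B1: "B1 \<in> Bs - {H}" and B2: "B2 \<in> Bs - {H}" and x: "x \<in> B1 - B2" for B1 B2 x
  proof -
    obtain y where y: "y \<in> B2" "y \<notin> B1" "insert y (B1 - {x}) \<in> Bs"
      using matroid_exchange[OF N, of B1 B2 x] B1 B2 x by auto
    show ?thesis
    proof (cases "insert y (B1 - {x}) = H")
      case False
      then show ?thesis using y by blast
    next
      case True
      then have B1eq: "B1 = insert x (H - {y})" and xy: "x \<notin> H" "y \<in> H"
        using x y by auto
      have "\<not> B2 \<subseteq> H"
        using card_subset_eq[OF H] card[of B2] B2 by auto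
      then obtain z where z: "z \<in> B2" "z \<notin> H" by auto
      have "insert z (H - {y}) \<in> Bs"
        using swap[OF xy(2,1) z(2), of B2] B1 B2 z x B1eq by auto
      moreover have "B1 - {x} = H - {y}"
        using B1eq xy by auto
      ultimately show ?thesis
        using z x B1eq by (intro bexI[of _ z]) auto
    qed
  qed
  then show ?thesis
    using N ne unfolding matroid_def by simp
qed

text \<open>After removing \<open>x\<close>, an element \<open>y\<close> can be added unless it lies
  in a tight set that misses \<open>x\<close>. The sets are nested, so it is enough to avoid the
  largest such set \<open>T\<close>. There \<open>B2\<close> has at most as many elements as
  \<open>B1\<close>, hence at least as many outside, while \<open>x\<close> is outside
  \<open>T\<close> and not in \<open>B2\<close>; so a suitable \<open>y\<close> exists.\<close>

lemma matroid_chain_capacity: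
  fixes S :: "nat \<Rightarrow> 'a set" and f :: "nat \<Rightarrow> nat"
  assumes fin: "finite E" and S: "mono S" and large: "E \<subseteq> S n"
    and ne: "{B. B \<subseteq> E \<and> card B = r \<and> (\<forall>t. card (B \<inter> S t) \<le> f t)} \<noteq> {}"
  shows "matroid (Set_System E {B. B \<subseteq> E \<and> card B = r \<and> (\<forall>t. card (B \<inter> S t) \<le> f t)})"
proof -
  have "\<exists>y\<in>B2 - B1. insert y (B1 - {x}) \<subseteq> E \<and> card (insert y (B1 - {x})) = r \<and>
          (\<forall>t. card (insert y (B1 - {x}) \<inter> S t) \<le> f t)"
    if B1: "B1 \<subseteq> E" "card B1 = r" "\<And>t. card (B1 \<inter> S t) \<le> f t"
      and B2: "B2 \<subseteq> E" "card B2 = r" "\<And>t. card (B2 \<inter> S t) \<le> f t"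
      and x: "x \<in> B1" "x \<notin> B2" for B1 B2 x
  proof -
    have f12: "finite B1" "finite B2" using B1 B2 fin finite_subset by blast+
    define tight where "tight = {t. x \<notin> S t \<and> card (B1 \<inter> S t) = f t}"
    \<comment> \<open>From index \<open>n\<close> on the sets contain all of \<open>E\<close>, in
      particular \<open>x\<close>; so only finitely many indices are tight and \<open>Max\<close> is
      meaningful.\<close>
    have "t \<le> n" if "t \<in> tight" for t
    proof (rule ccontr)
      assume "\<not> t \<le> n"
      then have "S n \<subseteq> S t" using S by (simp add: monoD)
      then show False using that x B1 large by (auto simp: tight_def)
    qed
    then have tfin: "finite tight"
      by (meson finite_nat_set_iff_bounded_le)
    obtain y where y: "y \<in> B2" "y \<notin> B1" and ny: "\<And>t. t \<in> tight \<Longrightarrow> y \<notin> S t"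
    proof (cases "tight = {}")
      case True
      have "\<not> B2 \<subseteq> B1"
        using card_subset_eq[OF f12(1), of B2] B1 B2 x by auto
      then show thesis using that True by blast
    next
      case False
      define T where "T = S (Max tight)"
      have mx: "Max tight \<in> tight" using False tfin by simp
      then have T: "x \<notin> T" "card (B1 \<inter> T) = f (Max tight)"
        by (auto simp: tight_def T_def)
      have "\<not> B2 - T \<subseteq> B1"
      proof
        assume "B2 - T \<subseteq> B1"
        then have "B2 - T \<subset> B1 - T"
          using x T by blast
        then have "card (B2 - T) < card (B1 - T)"
          using f12 by (simp add: psubset_card_mono)
        moreover have "card B1 = card (B1 \<inter> T) + card (B1 - T)" "card B2 = card (B2 \<inter> T) + card (B2 - T)"
          using f12 by (metis card_Int_Diff)+
        ultimately show False
          using T B1 B2(1,2) B2(3)[of "Max tight"] by (simp add: T_def)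
      qed
      then obtain y where "y \<in> B2" "y \<notin> T" "y \<notin> B1" by auto
      moreover have "S t \<subseteq> T" if "t \<in> tight" for t
        unfolding T_def using S tfin that by (simp add: monoD)
      ultimately show thesis using that by blast
    qed
    have cardC: "card (insert y (B1 - {x})) = r"
      using f12 x y B1 by (metis Diff_iff card.insert card.remove finite_Diff)
    have "card (insert y (B1 - {x}) \<inter> S t) \<le> f t" for t
    proof (cases "y \<in> S t")
      case False
      then have "insert y (B1 - {x}) \<inter> S t \<subseteq> B1 \<inter> S t" by auto
      then have "card (insert y (B1 - {x}) \<inter> S t) \<le> card (B1 \<inter> S t)"
        using f12 by (simp add: card_mono)
      then show ?thesis using B1(3)[of t] by linarith
    next
      case True
      have eq: "insert y (B1 - {x}) \<inter> S t = insert y ((B1 \<inter> S t) - {x})"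
        using True by auto
      have "y \<notin> (B1 \<inter> S t) - {x}" "finite ((B1 \<inter> S t) - {x})" using y f12 by auto
      then have c: "card (insert y (B1 - {x}) \<inter> S t) = Suc (card ((B1 \<inter> S t) - {x}))"
        unfolding eq by simp
      show ?thesis
      proof (cases "x \<in> S t")
        case True
        then have "Suc (card ((B1 \<inter> S t) - {x})) = card (B1 \<inter> S t)"
          using x f12 card_Suc_Diff1[of "B1 \<inter> S t" x] by simp
        then show ?thesis using c B1(3)[of t] by linarith
      next
        case False
        then have "card (B1 \<inter> S t) \<noteq> f t"
          using ny[of t] True by (auto simp: tight_def)
        then show ?thesis using c B1(3)[of t] False by simp
      qed
    qed
    then show ?thesis
      using y x B1 B2 cardC by (intro bexI[of _ y]) auto
  qed
  then show ?thesis
    using fin ne unfolding matroid_def by (simp; blast)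
qed

section \<open>Lattice path matroids and chains\<close>

text \<open>Converts the componentwise order into bounds on prefix counts, the form that capacities
  take. For the converse, testing at the head of \<open>ys\<close> yields the comparison of the
  heads.\<close>

lemma list_all2_le_iff_length_filter:
  fixes xs ys :: "'a :: linorder list"
  assumes "sorted_wrt (<) xs" "sorted_wrt (<) ys"
  shows "list_all2 (\<le>) xs ys \<longleftrightarrow> length xs = length ys \<and>
     (\<forall>t. length (filter (\<lambda>y. y \<le> t) ys) \<le> length (filter (\<lambda>x. x \<le> t) xs))"
    (is "_ \<longleftrightarrow> _ \<and> ?D xs ys")
proof
  assume "list_all2 (\<le>) xs ys"
  then have "length (filter (\<lambda>y. y \<le> t) ys) \<le> length (filter (\<lambda>x. x \<le> t) xs)" for t
    by (induction rule: list_all2_induct) auto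
  with \<open>list_all2 (\<le>) xs ys\<close> show "length xs = length ys \<and> ?D xs ys"
    by (simp add: list_all2_lengthD)
next
  assume "length xs = length ys \<and> ?D xs ys"
  then have "length xs = length ys" "?D xs ys" by auto
  then show "list_all2 (\<le>) xs ys"
    using assms
  proof (induction xs ys rule: list_induct2)
    case (Cons x xs y ys)
    have "filter (\<lambda>x. x \<le> y) (x # xs) \<noteq> []"
      using Cons.prems(1)[rule_format, of y] by auto
    then obtain z where "z \<in> set (x # xs)" "z \<le> y"
      by (auto simp: filter_empty_conv split: if_splits)
    then have xy: "x \<le> y"
      using Cons.prems(2) by auto
    have "length (filter (\<lambda>y. y \<le> t) ys) \<le> length (filter (\<lambda>x. x \<le> t) xs)" for t
    proof (cases "y \<le> t")
      case True
      moreover have "x \<le> t" using xy True by (rule order_trans)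
      ultimately show ?thesis using Cons.prems(1)[rule_format, of t] by simp
    next
      case False
      then have "filter (\<lambda>y. y \<le> t) ys = []"
        using Cons.prems(3) by (auto simp: filter_empty_conv)
      then show ?thesis by simp
    qed
    then show ?case using Cons xy by simp
  qed simp
qed

lemma comp_le_iff_card:
  assumes "finite A" "finite B"
  shows "comp_le A B \<longleftrightarrow> card A = card B \<and> (\<forall>t. card (B \<inter> {..t}) \<le> card (A \<inter> {..t}))"
proof -
  have len: "length (filter (\<lambda>x. x \<le> t) (sorted_list_of_set C)) = card (C \<inter> {..t})"
    if "finite C" for C and t :: nat
    using that distinct_card[of "filter (\<lambda>x. x \<le> t) (sorted_list_of_set C)"]
    by (simp add: Int_def)
  show ?thesis
    unfolding comp_le_def
    by (subst list_all2_le_iff_length_filter) (use assms len in auto)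
qed

text \<open>Prefixes start at 1 so that 0 stays free for the element added in a one-element
  extension.\<close>

lemma comp_le_iff_card_Icc:
  assumes "A \<subseteq> {1..n}" "B \<subseteq> {1..n}"
  shows "comp_le A B \<longleftrightarrow> card A = card B \<and> (\<forall>t. card (B \<inter> {1..t}) \<le> card (A \<inter> {1..t}))"
proof -
  have "finite A" "finite B" using assms finite_subset by blast+
  moreover have "C \<inter> {..t} = C \<inter> {1..t}" if "C \<subseteq> {1..n}" for C t
    using that by auto
  ultimately show ?thesis
    using assms by (simp add: comp_le_iff_card)
qed

lemma comp_le_refl: "comp_le A A"
  by (simp add: comp_le_def list_all2_refl)

lemma comp_le_card: "finite A \<Longrightarrow> finite B \<Longrightarrow> comp_le A B \<Longrightarrow> card A = card B"
  by (simp add: comp_le_iff_card)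

lemma comp_le_antisym:
  assumes "finite A" "finite B" "comp_le A B" "comp_le B A"
  shows "A = B"
proof -
  have "sorted_list_of_set A = sorted_list_of_set B"
    using assms(3,4) unfolding comp_le_def by (intro list_all2_antisym[of "(\<le>)" "(\<le>)"]) auto
  then show ?thesis
    using assms by (metis set_sorted_list_of_set)
qed

section \<open>Paths, ranks and covers of lattice path matroids\<close>

lemma ground_lpm [simp]: "ground (lpm n U L) = {1..n}"
  by (simp add: lpm_def)

lemma mem_bases_lpm:
  "B \<in> bases (lpm n U L) \<longleftrightarrow> B \<subseteq> {1..n} \<and> comp_le U B \<and> comp_le B L"
  by (simp add: lpm_def)

lemma path_pairsD:
  assumes "(U, L) \<in> path_pairs n"
  shows "U \<subseteq> {1..n}" "L \<subseteq> {1..n}" "comp_le U L" "finite U" "finite L"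
  using assms finite_subset[of _ "{1..n}"] by (auto simp: path_pairs_def)

lemma card_basis_lpm:
  assumes "(U, L) \<in> path_pairs n" "B \<in> bases (lpm n U L)"
  shows "finite B" "card B = card U"
proof -
  show fin: "finite B"
    using assms(2) finite_subset[of B "{1..n}"] by (auto simp: mem_bases_lpm)
  show "card B = card U"
    using comp_le_card[of U B] fin path_pairsD[OF assms(1)] assms(2) by (auto simp: mem_bases_lpm)
qed

lemma extreme_bases_lpm:
  assumes "(U, L) \<in> path_pairs n"
  shows "U \<in> bases (lpm n U L)" "L \<in> bases (lpm n U L)"
  using path_pairsD[OF assms] by (auto simp: mem_bases_lpm comp_le_refl)

text \<open>Each path is an extreme basis, so it is bounded by the corresponding path of the other
  pair in both directions.\<close>

lemma lpm_inject:
  assumes UL: "(U, L) \<in> path_pairs n" and UL': "(U', L') \<in> path_pairs n" 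
    and eq: "lpm n U L = lpm n U' L'"
  shows "U = U'" "L = L'"
proof -
  note ex = extreme_bases_lpm[OF UL] extreme_bases_lpm[OF UL']
  have "comp_le U U'" "comp_le U' U" "comp_le L L'" "comp_le L' L"
    using ex eq mem_bases_lpm by metis+
  then show "U = U'" "L = L'"
    using path_pairsD[OF UL] path_pairsD[OF UL'] comp_le_antisym by blast+
qed

lemma lpm_lessD:
  assumes "lpm_less n (lpm n U' L') (lpm n U L)" "(U', L') \<in> path_pairs n" "(U, L) \<in> path_pairs n"
  shows "card U' < card U"
proof -
  have q: "quotient_le (lpm n U' L') (lpm n U L)" and neq: "lpm n U' L' \<noteq> lpm n U L"
    using assms(1) by (auto simp: lpm_less_def)
  obtain B where "B \<in> bases (lpm n U L)" "U' \<subseteq> B"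
    using quotient_le_basis_extends[OF q extreme_bases_lpm(1)[OF assms(2)]] by blast
  then have "card U' \<le> card U"
    using card_basis_lpm[OF assms(3)] card_mono by metis
  moreover have "card U' \<noteq> card U"
    using quotient_le_rank_eq[OF q, of "card U"] card_basis_lpm[OF assms(2)]
      card_basis_lpm[OF assms(3)] neq by metis
  ultimately show ?thesis by simp
qed

text \<open>Rank strictly increases along the order, so a rank difference of one leaves no room for
  an intermediate matroid; being a cover reduces to being a quotient.\<close>

lemma lpm_cover_iff:
  assumes "(U', L') \<in> path_pairs n" "(U, L) \<in> path_pairs n" and card: "card U = Suc (card U')"
  shows "lpm_cover n (lpm n U' L') (lpm n U L) \<longleftrightarrow> quotient_le (lpm n U' L') (lpm n U L)"
proof
  assume q: "quotient_le (lpm n U' L') (lpm n U L)"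
  have "lpm n U' L' \<noteq> lpm n U L"
    using lpm_inject(1)[OF assms(1,2)] card by auto
  then have "lpm_less n (lpm n U' L') (lpm n U L)"
    using q assms(1,2) by (auto simp: lpm_less_def lpms_def)
  moreover have False
    if K: "lpm_less n (lpm n U' L') K" "lpm_less n K (lpm n U L)" for K
  proof -
    obtain U1 L1 where K': "K = lpm n U1 L1" "(U1, L1) \<in> path_pairs n"
      using K by (auto simp: lpm_less_def lpms_def)
    show False
      using lpm_lessD[OF K(1)[unfolded K'(1)] assms(1) K'(2)]
        lpm_lessD[OF K(2)[unfolded K'(1)] K'(2) assms(2)] card by simp
  qed
  ultimately show "lpm_cover n (lpm n U' L') (lpm n U L)"
    by (auto simp: lpm_cover_def)
qed (simp add: lpm_cover_def lpm_less_def)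

section \<open>Chains determined by their labels\<close>

lemma C_pair_nth: "k < n \<Longrightarrow> C_pair n \<sigma> \<tau> ! k = (\<sigma> (Suc k), \<tau> (Suc k))"
  by (simp add: C_pair_def del: upt_Suc)

lemma length_C_pair [simp]: "length (C_pair n \<sigma> \<tau>) = n"
  by (simp add: C_pair_def)

lemma image_permutes_Suc:
  assumes "\<tau> permutes {1..n}" "k < n"
  shows "\<tau> ` {1..Suc k} = insert (\<tau> (Suc k)) (\<tau> ` {1..k})" "\<tau> (Suc k) \<notin> \<tau> ` {1..k}"
    "\<tau> ` {1..Suc k} - {\<tau> (Suc k)} = \<tau> ` {1..k}"
proof -
  show 1: "\<tau> ` {1..Suc k} = insert (\<tau> (Suc k)) (\<tau> ` {1..k})"
    by (simp add: atLeastAtMostSuc_conv)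
  show 2: "\<tau> (Suc k) \<notin> \<tau> ` {1..k}"
    using permutes_inj[OF assms(1)] by (simp add: inj_image_mem_iff)
  show "\<tau> ` {1..Suc k} - {\<tau> (Suc k)} = \<tau> ` {1..k}"
    using 2 unfolding 1 by simp
qed

lemma C_pair_label_sequence_iff:
  assumes \<tau>: "\<tau> permutes {1..n}" and \<sigma>: "\<sigma> permutes {1..n}"
  shows "(\<exists>Ms. maximal_chain n Ms \<and> label_sequence n Ms (C_pair n \<sigma> \<tau>)) \<longleftrightarrow>
    (\<forall>k<n. (\<tau> ` {1..Suc k}, \<sigma> ` {1..Suc k}) \<in> path_pairs n \<and>
       quotient_le (lpm n (\<tau> ` {1..k}) (\<sigma> ` {1..k})) (lpm n (\<tau> ` {1..Suc k}) (\<sigma> ` {1..Suc k})))"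
    (is "?lhs \<longleftrightarrow> ?rhs")
proof -
  define U where "U k = \<tau> ` {1..k}" for k
  define L where "L k = \<sigma> ` {1..k}" for k
  have SucU: "U (Suc k) - {\<tau> (Suc k)} = U k" "\<tau> (Suc k) \<in> U (Suc k)" 
             "U (Suc k) = insert (\<tau> (Suc k)) (U k)" if "k < n" for k
    using image_permutes_Suc[OF \<tau> that] by (auto simp: U_def)
  have SucL: "L (Suc k) - {\<sigma> (Suc k)} = L k" "\<sigma> (Suc k) \<in> L (Suc k)" 
             "L (Suc k) = insert (\<sigma> (Suc k)) (L k)" if "k < n" for k
    using image_permutes_Suc[OF \<sigma> that] by (auto simp: L_def)
  have cardU: "card (U k) = k" for k
    using permutes_inj[OF \<tau>] by (simp add: U_def card_image inj_on_subset)
  have pp0: "(U 0, L 0) \<in> path_pairs n"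
    by (simp add: path_pairs_def U_def L_def comp_le_refl)
  show ?thesis
  proof
    assume ?lhs
    then obtain Ms where chain: "maximal_chain n Ms" 
      and lab: "\<And>k. k < n \<Longrightarrow> cover_label n (Ms ! k) (Ms ! Suc k) (\<sigma> (Suc k), \<tau> (Suc k))"
      by (auto simp: label_sequence_def C_pair_nth)
    \<comment> \<open>The chain starts at the empty paths. Since a matroid determines its paths, the
      next label fixes the next pair, so the labels leave no choice.\<close>
    have M: "Ms ! k = lpm n (U k) (L k) \<and> (U k, L k) \<in> path_pairs n" if "k \<le> n" for k
      using that
    proof (induction k)
      case 0
      then show ?case using chain pp0 by (simp add: maximal_chain_def U_def L_def)
    next
      case (Suc k)
      then have IH: "Ms ! k = lpm n (U k) (L k)" "(U k, L k) \<in> path_pairs n" and "k < n" by auto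
      obtain V K where VK: "\<tau> (Suc k) \<in> V" "\<sigma> (Suc k) \<in> K" "(V, K) \<in> path_pairs n"
        "(V - {\<tau> (Suc k)}, K - {\<sigma> (Suc k)}) \<in> path_pairs n" "Ms ! Suc k = lpm n V K"
        "Ms ! k = lpm n (V - {\<tau> (Suc k)}) (K - {\<sigma> (Suc k)})"
        using lab[OF \<open>k < n\<close>] by (auto simp: cover_label_def)
      have "V - {\<tau> (Suc k)} = U k" "K - {\<sigma> (Suc k)} = L k"
        using lpm_inject[OF VK(4) IH(2)] VK(6) IH(1) by simp_all
      then have "V = U (Suc k)" "K = L (Suc k)"
        using VK(1,2) SucU(3)[OF \<open>k < n\<close>] SucL(3)[OF \<open>k < n\<close>] by auto
      then show ?case using VK by simp
    qed
    show ?rhs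
    proof (intro allI impI)
      fix k assume "k < n"
      have "lpm_cover n (Ms ! k) (Ms ! Suc k)"
        using chain \<open>k < n\<close> by (simp add: maximal_chain_def)
      then show "(\<tau> ` {1..Suc k}, \<sigma> ` {1..Suc k}) \<in> path_pairs n \<and>
         quotient_le (lpm n (\<tau> ` {1..k}) (\<sigma> ` {1..k})) (lpm n (\<tau> ` {1..Suc k}) (\<sigma> ` {1..Suc k}))"
        using M[of k] M[of "Suc k"] \<open>k < n\<close>
        unfolding U_def L_def by (simp add: lpm_cover_def lpm_less_def)
    qed
  next
    assume rhs: ?rhs
    define Ms where "Ms = map (\<lambda>k. lpm n (U k) (L k)) [0..<Suc n]"
    have Ms: "Ms ! k = lpm n (U k) (L k)" if "k \<le> n" for k
      using that unfolding Ms_def by (simp del: upt_Suc)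
    have pp: "(U k, L k) \<in> path_pairs n" if "k \<le> n" for k
      using rhs pp0 that by (cases k) (auto simp: U_def L_def)
    have cover: "lpm_cover n (Ms ! k) (Ms ! Suc k)" if "k < n" for k
      using lpm_cover_iff[OF pp[of k] pp[of "Suc k"]] that rhs Ms[of k] Ms[of "Suc k"]
      by (simp add: cardU) (simp add: U_def L_def)
    have "U n = {1..n}" "L n = {1..n}"
      using permutes_image[OF \<tau>] permutes_image[OF \<sigma>] by (simp_all add: U_def L_def)
    then have "maximal_chain n Ms"
      using Ms cover unfolding maximal_chain_def by (simp add: Ms_def U_def L_def)
    moreover have "cover_label n (Ms ! k) (Ms ! Suc k) (\<sigma> (Suc k), \<tau> (Suc k))" if "k < n" for k
      unfolding cover_label_def
      using cover[OF that] SucU[OF that] SucL[OF that] pp[of k] pp[of "Suc k"] Ms[of k] Ms[of "Suc k"] that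
      by (intro conjI exI[of _ "U (Suc k)"] exI[of _ "L (Suc k)"] exI[of _ "\<sigma> (Suc k)"] 
          exI[of _ "\<tau> (Suc k)"]) simp_all
    then have "label_sequence n Ms (C_pair n \<sigma> \<tau>)"
      by (simp add: label_sequence_def C_pair_nth)
    ultimately show ?lhs by blast
  qed
qed

section \<open>Elementary quotients\<close>

text \<open>The bases of a nested (Schubert) matroid: a lattice path matroid whose lower path
  consists of the last \<open>card U\<close> elements.\<close>

definition dominated :: "nat \<Rightarrow> nat set \<Rightarrow> nat set set" where
  "dominated n U = {B. B \<subseteq> {1..n} \<and> comp_le U B}"

text \<open>
  An elementary quotient is realised on \<open>{0..n}\<close>, with \<open>0\<close> as the new element; it is placed at the
  position of the removed element \<open>u\<close> of the upper path.
\<close>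

definition aug_prefix :: "nat \<Rightarrow> nat \<Rightarrow> nat set" where
  "aug_prefix u t = (if u \<le> t then insert 0 {1..t} else {1..t})"

definition aug_bases :: "nat \<Rightarrow> nat set \<Rightarrow> nat \<Rightarrow> nat set set" where
  "aug_bases n U u = {B. B \<subseteq> {0..n} \<and> card B = card U \<and>
     (\<forall>t. card (B \<inter> aug_prefix u t) \<le> card (U \<inter> {1..t}))}"

lemma dominated_card: "U \<subseteq> {1..n} \<Longrightarrow> B \<in> dominated n U \<Longrightarrow> card B = card U"
  by (auto simp: dominated_def comp_le_iff_card_Icc)

lemma self_dominated: "U \<subseteq> {1..n} \<Longrightarrow> U \<in> dominated n U"
  by (simp add: dominated_def comp_le_refl)

lemma mem_aug_bases_iff:
  assumes "U \<subseteq> {1..n}" "0 \<notin> B"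
  shows "B \<in> aug_bases n U u \<longleftrightarrow> B \<in> dominated n U"
proof -
  have "B \<inter> aug_prefix u t = B \<inter> {1..t}" for t
    using assms by (auto simp: aug_prefix_def)
  moreover have "B \<subseteq> {0..n} \<longleftrightarrow> B \<subseteq> {1..n}"
    using assms(2) by (auto simp: Suc_le_eq intro!: gr0I)
  ultimately show ?thesis
    using assms by (auto simp: aug_bases_def dominated_def comp_le_iff_card_Icc)
qed

lemma card_prefix_remove:
  fixes U :: "nat set"
  assumes "finite U" "u \<in> U" "1 \<le> u"
  shows "card (U \<inter> {1..t}) = card ((U - {u}) \<inter> {1..t}) + (if u \<le> t then 1 else 0)"
proof (cases "u \<le> t")
  case True
  then have "U \<inter> {1..t} = insert u ((U - {u}) \<inter> {1..t})" using assms by auto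
  then show ?thesis using True assms by simp
next
  case False
  then have "U \<inter> {1..t} = (U - {u}) \<inter> {1..t}" by auto
  then show ?thesis using False by simp
qed

lemma insert_mem_aug_bases_iff:
  assumes "U \<subseteq> {1..n}" "u \<in> U" "0 \<notin> B"
  shows "insert 0 B \<in> aug_bases n U u \<longleftrightarrow> B \<in> dominated n (U - {u})"
proof -
  have fin: "finite U" using assms finite_subset by blast
  have u: "1 \<le> u" using assms by auto
  have "insert 0 B \<subseteq> {0..n} \<longleftrightarrow> B \<subseteq> {1..n}"
    using assms(3) by (auto simp: Suc_le_eq intro!: gr0I)
  moreover have "card (insert 0 B \<inter> aug_prefix u t) \<le> card (U \<inter> {1..t}) \<longleftrightarrow>
      card (B \<inter> {1..t}) \<le> card ((U - {u}) \<inter> {1..t})" if "finite B" for t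
  proof -
    have "insert 0 B \<inter> aug_prefix u t = (if u \<le> t then insert 0 (B \<inter> {1..t}) else B \<inter> {1..t})"
      using assms by (auto simp: aug_prefix_def)
    then show ?thesis
      using that assms(3) card_prefix_remove[OF fin assms(2) u, of t] by simp
  qed
  moreover have "card (insert 0 B) = card U \<longleftrightarrow> card B = card (U - {u})" if "finite B"
    using that assms fin card_Suc_Diff1[of U u] by auto
  moreover have "finite B" if "B \<subseteq> {1..n}" using that finite_subset by blast
  ultimately have "insert 0 B \<in> aug_bases n U u \<longleftrightarrow> B \<subseteq> {1..n} \<and> card B = card (U - {u}) \<and>
      (\<forall>t. card (B \<inter> {1..t}) \<le> card ((U - {u}) \<inter> {1..t}))"
    unfolding aug_bases_def by auto
  moreover have "U - {u} \<subseteq> {1..n}" using assms by auto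
  ultimately show ?thesis
    using comp_le_iff_card_Icc[of "U - {u}" n B] unfolding dominated_def by auto
qed

text \<open>A member containing 0 spends one unit of every capacity from \<open>u\<close> on, which
  leaves precisely the capacities of \<open>U - {u}\<close> for its other elements. So the capacity
  form gives exchange, and the union form gives the quotient.\<close>

lemma aug_bases_eq:
  assumes "U \<subseteq> {1..n}" "u \<in> U"
  shows "aug_bases n U u = dominated n U \<union> insert 0 ` dominated n (U - {u})"
proof (intro set_eqI)
  fix B
  have no0: "0 \<notin> A" if "A \<in> dominated n V" for A V
    using that by (auto simp: dominated_def)
  show "B \<in> aug_bases n U u \<longleftrightarrow> B \<in> dominated n U \<union> insert 0 ` dominated n (U - {u})"
  proof (cases "0 \<in> B")
    case False
    then show ?thesis using mem_aug_bases_iff[OF assms(1)] by auto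
  next
    case True
    then have eq: "insert 0 (B - {0}) = B" by auto
    have "B \<in> aug_bases n U u \<longleftrightarrow> B - {0} \<in> dominated n (U - {u})"
      using insert_mem_aug_bases_iff[OF assms, of "B - {0}"] unfolding eq by simp
    also have "\<dots> \<longleftrightarrow> B \<in> insert 0 ` dominated n (U - {u})"
    proof
      assume "B - {0} \<in> dominated n (U - {u})"
      then show "B \<in> insert 0 ` dominated n (U - {u})"
        by (rule rev_image_eqI) (rule eq[symmetric])
    next
      assume "B \<in> insert 0 ` dominated n (U - {u})"
      then obtain A where "A \<in> dominated n (U - {u})" "B = insert 0 A" by blast
      then show "B - {0} \<in> dominated n (U - {u})" using no0[of A] by simp
    qed
    finally show ?thesis using True no0[of B U] by blast
  qed
qed

lemma matroid_aug_bases: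
  assumes "U \<subseteq> {1..n}" "u \<in> U"
  shows "matroid (Set_System {0..n} (aug_bases n U u))"
  unfolding aug_bases_def
proof (rule matroid_chain_capacity)
  show "mono (aug_prefix u)"
    by (auto simp: mono_def aug_prefix_def)
  \<comment> \<open>The index \<open>n + u\<close> is beyond both \<open>n\<close> and
    \<open>u\<close>, so the prefix contains \<open>{1..n}\<close> and 0.\<close>
  show "{0..n} \<subseteq> aug_prefix u (n + u)"
    by (auto simp: aug_prefix_def)
  show "{B. B \<subseteq> {0..n} \<and> card B = card U \<and> (\<forall>t. card (B \<inter> aug_prefix u t) \<le> card (U \<inter> {1..t}))} \<noteq> {}"
  proof -
    have "aug_bases n U u \<noteq> {}"
      using self_dominated[OF assms(1)] unfolding aug_bases_eq[OF assms] by blast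
    then show ?thesis unfolding aug_bases_def .
  qed
qed simp

text \<open>Allows subfamilies of the dominated sets on both sides, so that one basis may be missing
  from either.\<close>

lemma quotient_le_aug:
  assumes U: "U \<subseteq> {1..n}" "u \<in> U" 
    and Bs: "Bs \<subseteq> dominated n U" "Bs \<noteq> {}" and Bs': "Bs' \<subseteq> dominated n (U - {u})" "Bs' \<noteq> {}"
    and N: "matroid (Set_System {0..n} (Bs \<union> insert 0 ` Bs'))"
  shows "quotient_le (Set_System {1..n} Bs') (Set_System {1..n} Bs)"
proof (rule quotient_le_extension)
  have "insert 0 {1..n} = {0..n}" by auto
  then show "matroid (Set_System (insert 0 {1..n}) (Bs \<union> insert 0 ` Bs'))"
    using N by simp
  have "finite U" using U finite_subset by blast
  then have card: "card U = Suc (card (U - {u}))"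
    using U(2) by (rule card.remove)
  show "B \<subseteq> {1..n} \<and> card B = Suc (card (U - {u}))" if "B \<in> Bs" for B
    using that Bs dominated_card[OF U(1), of B] card by (auto simp: dominated_def)
  show "B \<subseteq> {1..n} \<and> card B = card (U - {u})" if "B \<in> Bs'" for B
    using that Bs' dominated_card[of "U - {u}" n B] U by (auto simp: dominated_def)
qed (use Bs Bs' in auto)

text \<open>Explains why steps between two trivial lower paths put no restriction on the element
  that joins the upper path.\<close>

lemma quotient_le_dominated:
  assumes "U \<subseteq> {1..n}" "u \<in> U"
  shows "quotient_le (Set_System {1..n} (dominated n (U - {u}))) (Set_System {1..n} (dominated n U))"
  using matroid_aug_bases[OF assms] self_dominated[OF assms(1)] self_dominated[of "U - {u}" n] assms
  by (intro quotient_le_aug[OF assms]) (auto simp: aug_bases_eq[OF assms])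

text \<open>Replacing \<open>x\<close> by \<open>z\<close> raises the count only in prefixes that
  contain \<open>z\<close> but not \<open>x\<close>; only there is a bound required.\<close>

lemma aug_bases_swap:
  assumes "insert x A \<in> aug_bases n U u" "x \<notin> A" "z \<notin> A" "z \<le> n" "finite A"
    and swap: "\<And>t. z \<in> aug_prefix u t \<Longrightarrow> x \<notin> aug_prefix u t \<Longrightarrow> 
      Suc (card (A \<inter> aug_prefix u t)) \<le> card (U \<inter> {1..t})"
  shows "insert z A \<in> aug_bases n U u"
proof -
  have "card (insert z A \<inter> aug_prefix u t) \<le> card (U \<inter> {1..t})" for t
  proof -
    have "card (insert x A \<inter> aug_prefix u t) \<le> card (U \<inter> {1..t})"
      using assms(1) by (auto simp: aug_bases_def)
    then show ?thesis
      using swap[of t] assms(2,3,5) by (cases "x \<in> aug_prefix u t"; cases "z \<in> aug_prefix u t") auto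
  qed
  moreover have "insert z A \<subseteq> {0..n}" "card (insert z A) = card U"
    using assms(1-5) by (auto simp: aug_bases_def)
  ultimately show ?thesis by (simp add: aug_bases_def)
qed

lemma aug_bases_prefix_pos:
  assumes "B \<in> aug_bases n U u" "z \<in> B" "z \<in> aug_prefix u t"
  shows "1 \<le> card (U \<inter> {1..t})"
proof -
  have "B \<inter> aug_prefix u t \<noteq> {}" "finite (B \<inter> aug_prefix u t)"
    using assms by (auto simp: aug_prefix_def)
  then have "1 \<le> card (B \<inter> aug_prefix u t)"
    by (simp add: Suc_le_eq card_gt_0_iff)
  also have "\<dots> \<le> card (U \<inter> {1..t})"
    using assms by (auto simp: aug_bases_def)
  finally show ?thesis .
qed

section \<open>Quotients into and out of the exceptional lower path\<close>

lemma card_prefix_suffix: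
  fixes U :: "nat set"
  assumes "U \<subseteq> {1..n}"
  shows "card U = card (U \<inter> {1..t}) + card (U \<inter> {t<..n})"
proof -
  have "finite U" using assms finite_subset by blast
  moreover have "U - {1..t} = U \<inter> {t<..n}" using assms by auto
  ultimately show ?thesis
    using card_Int_Diff[of U "{1..t}"] by simp
qed

lemma card_Int_Ioc_le: "card (U \<inter> {t<..n}) \<le> n - t" for U :: "nat set"
  using card_mono[of "{t<..n}" "U \<inter> {t<..n}"] by simp

text \<open>Here the larger matroid lacks \<open>{i+1..n}\<close>. A gap of \<open>U\<close> above
  \<open>a\<close> leaves the slack for substitutes. Without a gap, \<open>U\<close> is full from
  \<open>a\<close> on; then \<open>{i+1..n} - {a}\<close> is a basis of the smaller matroid, but the
  only dominated set extending it is the missing one.\<close>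

lemma quotient_le_remove_suffix_iff:
  assumes U: "U \<subseteq> {1..n}" "a \<in> U" and i: "i < n" and card: "card U = n - i"
    and ne: "U \<noteq> {i+1..n}"
  shows "quotient_le (Set_System {1..n} (dominated n (U - {a})))
           (Set_System {1..n} (dominated n U - {{i+1..n}})) \<longleftrightarrow> (\<exists>w. a < w \<and> w \<le> n \<and> w \<notin> U)"
proof
  let ?H = "{i+1..n}"
  assume "\<exists>w. a < w \<and> w \<le> n \<and> w \<notin> U"
  then obtain w where w: "a < w" "w \<le> n" "w \<notin> U" by blast
  have no0: "0 \<notin> ?H" by simp
  have eq: "dominated n U - {?H} \<union> insert 0 ` dominated n (U - {a}) = aug_bases n U a - {?H}"
    using no0 unfolding aug_bases_eq[OF U] by blast
  have "matroid (Set_System {0..n} (aug_bases n U a - {?H}))"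
  proof (rule matroid_remove_basis[OF matroid_aug_bases[OF U]])
    show "aug_bases n U a - {?H} \<noteq> {}"
      using ne self_dominated[OF U(1)] unfolding aug_bases_eq[OF U] by blast
    show "card B = card ?H" if "B \<in> aug_bases n U a" for B
      using that card by (simp add: aug_bases_def)
  next
    fix x y z B
    assume y: "y \<in> ?H" and x: "x \<notin> ?H" and z: "z \<notin> ?H" 
      and xH: "insert x (?H - {y}) \<in> aug_bases n U a" and B: "B \<in> aug_bases n U a" "z \<in> B"
    have xi: "x \<le> i" "z \<le> i" using x z xH B by (auto simp: aug_bases_def)
    show "insert z (?H - {y}) \<in> aug_bases n U a"
    proof (rule aug_bases_swap[OF xH])
      fix t assume t: "z \<in> aug_prefix a t" "x \<notin> aug_prefix a t"
      show "Suc (card ((?H - {y}) \<inter> aug_prefix a t)) \<le> card (U \<inter> {1..t})"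
      proof (cases "t \<le> i")
        case True
        then have "(?H - {y}) \<inter> aug_prefix a t = {}"
          by (auto simp: aug_prefix_def)
        then show ?thesis
          using aug_bases_prefix_pos[OF B t(1)] by simp
      next
        case False
        \<comment> \<open>A positive \<open>x \<le> i\<close> lies in every prefix beyond
          \<open>i\<close>; only the new element can be absent, and only before its position
          \<open>a\<close>.\<close>
        with t xi have t': "t < a" "x = 0"
          by (auto simp: aug_prefix_def split: if_splits)
        have "(?H - {y}) \<inter> aug_prefix a t \<subseteq> {i+1..t}"
          using t' by (auto simp: aug_prefix_def)
        then have "card ((?H - {y}) \<inter> aug_prefix a t) \<le> t - i"
          using card_mono[of "{i+1..t}"] by fastforce
        \<comment> \<open>The gap lies beyond \<open>t\<close>, so \<open>U\<close> has fewer than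
          \<open>n - t\<close> elements there and more than \<open>t - i\<close> up to
          \<open>t\<close>: one place remains for \<open>z\<close>.\<close>
        moreover have "w \<in> {t<..n}" using w t' by simp
        then have "U \<inter> {t<..n} \<subset> {t<..n}"
          using w(3) by blast
        then have "card (U \<inter> {t<..n}) < n - t"
          using psubset_card_mono[of "{t<..n}" "U \<inter> {t<..n}"] by simp
        ultimately show ?thesis
          using card_prefix_suffix[OF U(1), of t] card False by linarith
      qed
    qed (use x z xi i in auto)
  qed simp
  then show "quotient_le (Set_System {1..n} (dominated n (U - {a})))
     (Set_System {1..n} (dominated n U - {?H}))"
    using ne self_dominated[OF U(1)] self_dominated[of "U - {a}" n] U(1) unfolding eq[symmetric]
    by (intro quotient_le_aug[OF U]) blast+
next
  let ?H = "{i+1..n}"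
  have finU: "finite U" using U finite_subset by blast
  assume q: "quotient_le (Set_System {1..n} (dominated n (U - {a})))
     (Set_System {1..n} (dominated n U - {?H}))"
  show "\<exists>w. a < w \<and> w \<le> n \<and> w \<notin> U"
  proof (rule ccontr)
    assume no: "\<not> ?thesis"
    then have sub: "{a..n} \<subseteq> U" using U by (auto simp: le_less)
    then have Ut: "U \<inter> {t<..n} = {t<..n}" if "a \<le> Suc t" for t
      using that by auto
    have ai: "i < a"
    proof (rule ccontr)
      assume "\<not> i < a"
      then have "?H \<subset> {a..n}" using U i by auto
      then have "?H \<subset> U" using sub by blast
      then show False using psubset_card_mono[OF finU, of ?H] card by simp
    qed
    have aH: "a \<in> ?H" using ai U by auto
    \<comment> \<open>For \<open>t \<ge> a\<close> both sets are full beyond \<open>t\<close>, so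
      their counts agree; for \<open>t < a\<close> the removal is invisible, and \<open>?H\<close>
      is the latest set of its size.\<close>
    have "card ((?H - {a}) \<inter> {1..t}) \<le> card ((U - {a}) \<inter> {1..t})" if "t \<le> n" for t
    proof (cases "a \<le> t")
      case True
      have "?H \<inter> {t<..n} = U \<inter> {t<..n}" using Ut[of t] True ai by auto
      then have "card (?H \<inter> {1..t}) = card (U \<inter> {1..t})"
        using card_prefix_suffix[of ?H n t] card_prefix_suffix[OF U(1), of t] card by simp
      then show ?thesis
        using card_prefix_remove[OF finU U(2), of t] card_prefix_remove[of ?H a t] aH True by simp
    next
      case False
      have "card (?H \<inter> {1..t}) \<le> card (U \<inter> {1..t})"
      proof -
        have "?H \<inter> {1..t} = {i+1..t}" using that by auto
        with card_Int_Ioc_le[of U t n] show ?thesis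
          using card_prefix_suffix[OF U(1), of t] card that by simp
      qed
      then show ?thesis
        using card_prefix_remove[OF finU U(2), of t] card_prefix_remove[of ?H a t] aH False by simp
    qed
    moreover have "card ((?H - {a}) \<inter> {1..t}) \<le> card ((U - {a}) \<inter> {1..t})" if "n < t" for t
    proof -
      have "(?H - {a}) \<inter> {1..t} = ?H - {a}" "(U - {a}) \<inter> {1..t} = U - {a}"
        using that U by fastforce+
      then show ?thesis using card aH U finU by simp
    qed
    ultimately have "card ((?H - {a}) \<inter> {1..t}) \<le> card ((U - {a}) \<inter> {1..t})" for t
      by (cases "t \<le> n") auto
    moreover have "U - {a} \<subseteq> {1..n}" "?H - {a} \<subseteq> {1..n}" using U(1) by auto
    moreover have "card (U - {a}) = card (?H - {a})" using U(2) aH card finU by simp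
    ultimately have "?H - {a} \<in> dominated n (U - {a})"
      using comp_le_iff_card_Icc[of "U - {a}" n "?H - {a}"] unfolding dominated_def by blast
    then obtain B where B: "B \<in> dominated n U" "B \<noteq> ?H" "?H - {a} \<subseteq> B"
      using quotient_le_basis_extends[OF q, of "?H - {a}"] by auto
    have Bn: "B \<subseteq> {1..n}" "card B = card U" using B dominated_card[OF U(1)] by (auto simp: dominated_def)
    have finB: "finite B" using Bn finite_subset by blast
    have "a \<notin> B"
    proof
      assume "a \<in> B"
      then have "?H \<subseteq> B" using B by blast
      then have "?H = B" using card_subset_eq[OF finB] Bn card by simp
      with B show False by blast
    qed
    \<comment> \<open>\<open>B\<close> has no more elements than \<open>U\<close> below
      \<open>a\<close> and, missing \<open>a\<close>, strictly fewer from there on, although the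
      sizes agree.\<close>
    have "card (B \<inter> {1..a-1}) \<le> card (U \<inter> {1..a-1})"
      using B U comp_le_iff_card_Icc[of U n B] by (auto simp: dominated_def)
    moreover have "card (B \<inter> {a-1<..n}) < card (U \<inter> {a-1<..n})"
    proof (rule psubset_card_mono)
      show "B \<inter> {a-1<..n} \<subset> U \<inter> {a-1<..n}"
      proof -
        have "a \<in> U \<inter> {a-1<..n}" using U by auto
        moreover have "U \<inter> {a-1<..n} = {a-1<..n}" using Ut[of "a-1"] by simp
        ultimately show ?thesis using \<open>a \<notin> B\<close> by blast
      qed
    qed simp
    ultimately show False
      using card_prefix_suffix[OF U(1), of "a-1"] card_prefix_suffix[OF Bn(1), of "a-1"] Bn(2) by linarith
  qed
qed

text \<open>Now the smaller matroid lacks \<open>{i+1..n}\<close>, so the basis removed from the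
  extension also contains 0. A smaller \<open>c\<close> gives room for both 0 and a substitute. If
  instead \<open>b\<close> is the least element of \<open>U\<close>, then
  \<open>insert b {i+1..n}\<close> is a basis of the larger matroid, and any basis of the smaller
  one inside it would have to contain \<open>b\<close>, which \<open>U - {b}\<close> does not
  permit.\<close>

lemma quotient_le_from_removed_suffix_iff:
  assumes U: "U \<subseteq> {1..n}" "b \<in> U" and i: "1 \<le> i" "i < n" and card: "card U = Suc (n - i)"
    and ne: "U - {b} \<noteq> {i+1..n}"
  shows "quotient_le (Set_System {1..n} (dominated n (U - {b}) - {{i+1..n}}))
           (Set_System {1..n} (dominated n U)) \<longleftrightarrow> (\<exists>c\<in>U. c < b)"
proof
  let ?H = "{i+1..n}"
  assume "\<exists>c\<in>U. c < b"
  then obtain c where c: "c \<in> U" "c < b" by blast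
  have no0: "0 \<notin> A" if "A \<in> dominated n V" for A V
    using that by (auto simp: dominated_def)
  have eq: "dominated n U \<union> insert 0 ` (dominated n (U - {b}) - {?H}) = aug_bases n U b - {insert 0 ?H}"
  proof -
    have "0 \<notin> A" if "A \<in> dominated n (U - {b}) \<union> {?H}" for A
      using that no0 by auto
    then have "inj_on (insert 0) (dominated n (U - {b}) \<union> {?H})"
      by (intro inj_onI) (metis insert_ident)
    then have "insert 0 ` (dominated n (U - {b}) - {?H}) = insert 0 ` dominated n (U - {b}) - {insert 0 ?H}"
      using inj_on_image_set_diff[of "insert 0" _ "dominated n (U - {b})" "{?H}"] by auto
    moreover have "insert 0 ?H \<notin> dominated n U" using no0 by blast
    ultimately show ?thesis unfolding aug_bases_eq[OF U] by blast
  qed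
  have "matroid (Set_System {0..n} (aug_bases n U b - {insert 0 ?H}))"
  proof (rule matroid_remove_basis[OF matroid_aug_bases[OF U]])
    show "aug_bases n U b - {insert 0 ?H} \<noteq> {}"
      using self_dominated[OF U(1)] unfolding eq[symmetric] by blast
    show "card B = card (insert 0 ?H)" if "B \<in> aug_bases n U b" for B
      using that card by (simp add: aug_bases_def)
  next
    fix x y z B
    assume y: "y \<in> insert 0 ?H" and x: "x \<notin> insert 0 ?H" and z: "z \<notin> insert 0 ?H" 
      and xH: "insert x (insert 0 ?H - {y}) \<in> aug_bases n U b" and B: "B \<in> aug_bases n U b" "z \<in> B"
    have xi: "x \<le> i" "z \<le> i" using x z xH B by (auto simp: aug_bases_def)
    show "insert z (insert 0 ?H - {y}) \<in> aug_bases n U b"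
    proof (rule aug_bases_swap[OF xH])
      fix t assume t: "z \<in> aug_prefix b t" "x \<notin> aug_prefix b t"
      \<comment> \<open>This time \<open>x\<close> is not 0, so its absence from the prefix means
        \<open>t < x \<le> i\<close>, and no element of \<open>?H\<close> has been reached.\<close>
      then have ti: "t < i" using xi x by (auto simp: aug_prefix_def split: if_splits)
      show "Suc (card ((insert 0 ?H - {y}) \<inter> aug_prefix b t)) \<le> card (U \<inter> {1..t})"
      proof (cases "b \<le> t")
        case True
        have "(insert 0 ?H - {y}) \<inter> aug_prefix b t \<subseteq> {0}"
          using ti by (auto simp: aug_prefix_def)
        then have "card ((insert 0 ?H - {y}) \<inter> aug_prefix b t) \<le> 1"
          using card_mono[of "{0}" "(insert 0 ?H - {y}) \<inter> aug_prefix b t"] by simp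
        \<comment> \<open>Capacity two is needed: one unit for 0, which is counted from
          \<open>b\<close> on, and one for \<open>z\<close>.\<close>
        moreover have "{c, b} \<subseteq> U \<inter> {1..t}" using c U True by auto
        then have "card {c, b} \<le> card (U \<inter> {1..t})" by (intro card_mono) auto
        then have "2 \<le> card (U \<inter> {1..t})" using c by simp
        ultimately show ?thesis by linarith
      next
        case False
        then have "(insert 0 ?H - {y}) \<inter> aug_prefix b t = {}"
          using ti by (auto simp: aug_prefix_def)
        then show ?thesis
          using aug_bases_prefix_pos[OF B t(1)] by simp
      qed
    qed (use x z xi i in auto)
  qed simp
  then show "quotient_le (Set_System {1..n} (dominated n (U - {b}) - {?H}))
           (Set_System {1..n} (dominated n U))"
    using ne self_dominated[OF U(1)] self_dominated[of "U - {b}" n] U(1) unfolding eq[symmetric]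
    by (intro quotient_le_aug[OF U]) blast+
next
  let ?H = "{i+1..n}"
  have finU: "finite U" using U finite_subset by blast
  assume q: "quotient_le (Set_System {1..n} (dominated n (U - {b}) - {?H}))
           (Set_System {1..n} (dominated n U))"
  show "\<exists>c\<in>U. c < b"
  proof (rule ccontr)
    assume "\<not> ?thesis"
    then have min: "\<And>c. c \<in> U \<Longrightarrow> b \<le> c" by force
    have bi: "b \<le> i"
    proof (rule ccontr)
      assume "\<not> b \<le> i"
      then have "U \<subseteq> ?H" using min U by fastforce
      then show False using card_mono[of ?H U] card by simp
    qed
    have "card (insert b ?H \<inter> {1..t}) \<le> card (U \<inter> {1..t})" for t
    proof (cases "t \<le> i")
      case True
      then have "insert b ?H \<inter> {1..t} \<subseteq> U \<inter> {1..t}" using U by auto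
      then show ?thesis by (intro card_mono) auto
    next
      case False
      have "insert b ?H \<inter> {1..t} \<subseteq> insert b {i+1..min n t}" by auto
      then have "card (insert b ?H \<inter> {1..t}) \<le> card (insert b {i+1..min n t})" by (intro card_mono) auto
      also have "\<dots> = Suc (min n t - i)" using bi by simp
      finally have "card (insert b ?H \<inter> {1..t}) \<le> Suc (min n t - i)" .
      then show ?thesis
        using card_Int_Ioc_le[of U t n] card_prefix_suffix[OF U(1), of t] card i False by linarith
    qed
    then have "insert b ?H \<in> dominated n U"
      using comp_le_iff_card_Icc[of U n "insert b ?H"] U bi card
      by (auto simp: dominated_def)
    then obtain B where B: "B \<in> dominated n (U - {b})" "B \<noteq> ?H" "B \<subseteq> insert b ?H"
      using quotient_le_basis_restricts[OF q, of "insert b ?H"] by auto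
    have Ub: "U - {b} \<subseteq> {1..n}" using U by blast
    have "card B = card (U - {b})" using B dominated_card[OF Ub] by simp
    then have cB: "card B = card ?H" using card U finU by simp
    have "b \<in> B" 
      using B card_subset_eq[of ?H B] cB by blast
    moreover have "card (B \<inter> {1..b}) \<le> card ((U - {b}) \<inter> {1..b})"
      using B Ub comp_le_iff_card_Icc[of "U - {b}" n B] by (auto simp: dominated_def)
    moreover have "(U - {b}) \<inter> {1..b} = {}" using min by force
    ultimately have "B \<inter> {1..b} = {}" by simp
    moreover have "b \<in> B \<inter> {1..b}" using \<open>b \<in> B\<close> U by auto
    ultimately show False by blast
  qed
qed

section \<open>The trivial lower paths and the exceptional one\<close>

lemma bases_lpm_top:
  assumes U: "U \<subseteq> {1..n}" "card U = k" and k: "k \<le> n"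
  shows "bases (lpm n U {n+1-k..n}) = dominated n U" "(U, {n+1-k..n}) \<in> path_pairs n"
proof -
  have "comp_le B {n+1-k..n}" if B: "B \<subseteq> {1..n}" "card B = k" for B
  proof -
    have "card ({n+1-k..n} \<inter> {1..t}) \<le> card (B \<inter> {1..t})" for t :: nat
    proof -
      have "{n+1-k..n} \<inter> {1..t} \<subseteq> {n+1-k..min n t}" by auto
      then have "card ({n+1-k..n} \<inter> {1..t}) \<le> min n t + k - n"
        using card_mono[of "{n+1-k..min n t}"] k by fastforce
      then show ?thesis
        using card_Int_Ioc_le[of B t n] card_prefix_suffix[OF B(1), of t] B(2) k by linarith
    qed
    moreover have "{n+1-k..n} \<subseteq> {1..n}" "card {n+1-k..n} = k" using k by auto
    ultimately show ?thesis
      using B comp_le_iff_card_Icc[of B n "{n+1-k..n}"] by simp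
  qed
  note * = this
  show "bases (lpm n U {n+1-k..n}) = dominated n U"
  proof (rule set_eqI)
    fix B
    show "B \<in> bases (lpm n U {n+1-k..n}) \<longleftrightarrow> B \<in> dominated n U"
      using *[of B] dominated_card[OF U(1), of B] U(2)
      unfolding mem_bases_lpm dominated_def mem_Collect_eq by blast
  qed
  show "(U, {n+1-k..n}) \<in> path_pairs n"
    using *[OF U] U k by (auto simp: path_pairs_def)
qed

text \<open>The set \<open>insert i {i+2..n}\<close> is the greatest but one among the sets of its
  size. Any \<open>B\<close> other than \<open>{i+1..n}\<close> has an element at most
  \<open>i\<close>, which pays for the early element \<open>i\<close>; beyond that the size of
  \<open>B\<close> alone forces the bound.\<close>

lemma comp_le_bumped_suffix_iff:
  assumes B: "B \<subseteq> {1..n}" "card B = n - i" and i: "1 \<le> i" "i < n"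
  shows "comp_le B (insert i {i+2..n}) \<longleftrightarrow> B \<noteq> {i+1..n}"
proof -
  let ?L = "insert i {i+2..n}"
  have finB: "finite B" using B finite_subset by blast
  have L: "?L \<subseteq> {1..n}" "card ?L = n - i" using i by auto
  have iff: "comp_le B ?L \<longleftrightarrow> (\<forall>t. card (?L \<inter> {1..t}) \<le> card (B \<inter> {1..t}))"
    using comp_le_iff_card_Icc[OF B(1) L(1)] B L by simp
  show ?thesis
  proof
    assume "comp_le B ?L"
    then have "card (?L \<inter> {1..i}) \<le> card (B \<inter> {1..i})" using iff by blast
    moreover have "?L \<inter> {1..i} = {i}" using i by auto
    ultimately have "B \<inter> {1..i} \<noteq> {}" by auto
    then show "B \<noteq> {i+1..n}" by auto
  next
    assume ne: "B \<noteq> {i+1..n}"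
    have "\<not> B \<subseteq> {i+1..n}"
      using card_subset_eq[of "{i+1..n}" B] ne B by auto
    then obtain x where x: "x \<in> B" "1 \<le> x" "x \<le> i" using B by force
    have "card (?L \<inter> {1..t}) \<le> card (B \<inter> {1..t})" for t
    proof (cases "t \<le> i + 1")
      case True
      show ?thesis
      proof (cases "i \<le> t")
        case True
        then have "?L \<inter> {1..t} \<subseteq> {i}" using \<open>t \<le> i + 1\<close> by auto
        then have "card (?L \<inter> {1..t}) \<le> 1" using card_mono[of "{i}"] by fastforce
        moreover have "{x} \<subseteq> B \<inter> {1..t}" using x True by auto
        then have "card {x} \<le> card (B \<inter> {1..t})" by (intro card_mono) auto
        ultimately show ?thesis by simp
      next
        case False
        then have "?L \<inter> {1..t} = {}" by auto
        then show ?thesis by simp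
      qed
    next
      case False
      have "?L \<inter> {1..t} \<subseteq> insert i {i+2..min n t}" by auto
      then have "card (?L \<inter> {1..t}) \<le> card (insert i {i+2..min n t})" by (intro card_mono) auto
      also have "\<dots> = Suc (min n t - (i + 1))" by simp
      finally have "card (?L \<inter> {1..t}) \<le> Suc (min n t - (i + 1))" .
      then show ?thesis
        using card_Int_Ioc_le[of B t n] card_prefix_suffix[OF B(1), of t] B(2) i False by linarith
    qed
    then show "comp_le B ?L" using iff by blast
  qed
qed

lemma bases_lpm_bumped:
  assumes U: "U \<subseteq> {1..n}" "card U = n - i" and i: "1 \<le> i" "i < n"
  shows "bases (lpm n U (insert i {i+2..n})) = dominated n U - {{i+1..n}}"
    "(U, insert i {i+2..n}) \<in> path_pairs n \<longleftrightarrow> U \<noteq> {i+1..n}"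
proof -
  show "bases (lpm n U (insert i {i+2..n})) = dominated n U - {{i+1..n}}"
  proof (rule set_eqI)
    fix B
    show "B \<in> bases (lpm n U (insert i {i+2..n})) \<longleftrightarrow> B \<in> dominated n U - {{i+1..n}}"
      using comp_le_bumped_suffix_iff[OF _ _ i, of B] dominated_card[OF U(1), of B] U(2)
      unfolding mem_bases_lpm dominated_def mem_Collect_eq Diff_iff by auto
  qed
  show "(U, insert i {i+2..n}) \<in> path_pairs n \<longleftrightarrow> U \<noteq> {i+1..n}"
    using comp_le_bumped_suffix_iff[OF U i] U i by (auto simp: path_pairs_def)
qed

section \<open>Counting permutations\<close>

text \<open>The cases \<open>Q j\<close> partition the permutations into classes of equal size, because each can be
  carried into any other by precomposition with a fixed permutation.\<close>

lemma card_permutes_symmetric_cases: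
  fixes Q :: "'i \<Rightarrow> ('a \<Rightarrow> 'a) \<Rightarrow> bool"
  assumes X: "finite X" and I: "finite I" "j \<in> I"
    and ex1: "\<And>\<tau>. \<tau> permutes X \<Longrightarrow> \<exists>!k. k \<in> I \<and> Q k \<tau>"
    and swap: "\<And>k l. k \<in> I \<Longrightarrow> l \<in> I \<Longrightarrow>
      \<exists>\<pi>. \<pi> permutes X \<and> (\<forall>\<tau>. \<tau> permutes X \<longrightarrow> Q k \<tau> \<longrightarrow> Q l (\<tau> \<circ> \<pi>))"
  shows "card {\<tau>. \<tau> permutes X \<and> Q j \<tau>} * card I = fact (card X)"
proof -
  define P where "P k = {\<tau>. \<tau> permutes X \<and> Q k \<tau>}" for k
  have fin: "finite (P k)" for k
    using finite_permutations[OF X] by (rule rev_finite_subset) (auto simp: P_def)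
  have le: "card (P k) \<le> card (P l)" if kl: "k \<in> I" "l \<in> I" for k l
  proof -
    obtain \<pi> where \<pi>: "\<pi> permutes X" "\<And>\<tau>. \<tau> permutes X \<Longrightarrow> Q k \<tau> \<Longrightarrow> Q l (\<tau> \<circ> \<pi>)"
      using swap[OF kl] by blast
    show ?thesis
    proof (rule card_inj_on_le)
      show "inj_on (\<lambda>\<tau>. \<tau> \<circ> \<pi>) (P k)"
        using permutes_surj[OF \<pi>(1)] by (intro inj_onI) (metis fun.inj_map_strong surj_fun_eq)
      show "(\<lambda>\<tau>. \<tau> \<circ> \<pi>) ` P k \<subseteq> P l"
        using \<pi> by (auto simp: P_def permutes_compose)
    qed (rule fin)
  qed
  have "fact (card X) = card {\<tau>. \<tau> permutes X}"
    using card_permutations[OF refl X] by simp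
  also have "{\<tau>. \<tau> permutes X} = (\<Union>k\<in>I. P k)"
    using ex1 by (fastforce simp: P_def)
  also have "card \<dots> = (\<Sum>k\<in>I. card (P k))"
    using I fin ex1 by (intro card_UN_disjoint) (auto simp: P_def)
  also have "\<dots> = (\<Sum>k\<in>I. card (P j))"
    using le I(2) by (intro sum.cong refl antisym) auto
  finally show ?thesis
    by (simp add: P_def mult.commute)
qed

section \<open>Permutations with prescribed extremal entries\<close>

lemma ex1_argmin:
  fixes f :: "'a \<Rightarrow> 'b :: linorder"
  assumes "finite S" "S \<noteq> {}" "inj_on f S"
  shows "\<exists>!p. p \<in> S \<and> (\<forall>s\<in>S. f p \<le> f s)"
proof -
  have "Min (f ` S) \<in> f ` S"
    using assms by (intro Min_in) auto
  then obtain p where "p \<in> S" "f p = Min (f ` S)"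
    by force
  then have p: "p \<in> S" "\<forall>s\<in>S. f p \<le> f s"
    using assms by simp_all
  have "p' = p" if "p' \<in> S" "\<forall>s\<in>S. f p' \<le> f s" for p'
    using that p by (intro inj_onD[OF assms(3)] antisym) auto
  with p show ?thesis by blast
qed

lemma permutes_inj_on_comp:
  assumes "\<tau> permutes X" "S \<subseteq> X" "inj_on f X"
  shows "inj_on (\<lambda>s. f (\<tau> s)) S"
proof -
  have "\<tau> ` S \<subseteq> X"
    using assms permutes_in_image by fastforce
  then show ?thesis
    using permutes_inj_on[OF assms(1), of S] assms(3) 
    by (metis comp_inj_on comp_def inj_on_subset inj_on_cong)
qed

text \<open>Transposing positions shows that each position of \<open>S\<close> is equally often the
  minimal one. The key \<open>f\<close> lets negation turn this into a statement about
  maxima.\<close>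

lemma card_permutes_argmin:
  fixes f :: "'a \<Rightarrow> 'b :: linorder"
  assumes X: "finite X" and S: "S \<subseteq> X" "p \<in> S" and f: "inj_on f X"
  shows "card {\<tau>. \<tau> permutes X \<and> (\<forall>s\<in>S. f (\<tau> p) \<le> f (\<tau> s))} * card S = fact (card X)"
proof (rule card_permutes_symmetric_cases[OF X _ S(2)])
  show finS: "finite S" using S X finite_subset by blast
  show "\<exists>!p. p \<in> S \<and> (\<forall>s\<in>S. f (\<tau> p) \<le> f (\<tau> s))" if "\<tau> permutes X" for \<tau>
    using ex1_argmin[OF finS _ permutes_inj_on_comp[OF that S(1) f]] S(2) by blast
  show "\<exists>\<pi>. \<pi> permutes X \<and> (\<forall>\<tau>. \<tau> permutes X \<longrightarrow> (\<forall>s\<in>S. f (\<tau> k) \<le> f (\<tau> s)) \<longrightarrow>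
      (\<forall>s\<in>S. f ((\<tau> \<circ> \<pi>) l) \<le> f ((\<tau> \<circ> \<pi>) s)))" if "k \<in> S" "l \<in> S" for k l
    using that S(1) by (intro exI[of _ "transpose k l"] conjI permutes_swap_id) (auto simp: transpose_def)
qed

text \<open>As \<open>S\<close> and \<open>T\<close> are disjoint, a transposition within one does
  not disturb the other; so all pairs of extremal positions are equally frequent.\<close>

lemma card_permutes_argmin2:
  fixes f :: "'a \<Rightarrow> 'b :: linorder" and g :: "'a \<Rightarrow> 'c :: linorder"
  assumes X: "finite X" and S: "S \<subseteq> X" "p \<in> S" and T: "T \<subseteq> X" "q \<in> T" 
    and disj: "S \<inter> T = {}" and f: "inj_on f X" and g: "inj_on g X"
  shows "card {\<tau>. \<tau> permutes X \<and> (\<forall>s\<in>S. f (\<tau> p) \<le> f (\<tau> s)) \<and> (\<forall>t\<in>T. g (\<tau> q) \<le> g (\<tau> t))}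
    * (card S * card T) = fact (card X)"
proof -
  define Q where "Q = (\<lambda>(p, q) \<tau>. (\<forall>s\<in>S. f (\<tau> p) \<le> f (\<tau> s)) \<and> (\<forall>t\<in>T. g (\<tau> q) \<le> g (\<tau> t)))"
  have fin: "finite S" "finite T" using S T X finite_subset by blast+
  have "card {\<tau>. \<tau> permutes X \<and> Q (p, q) \<tau>} * card (S \<times> T) = fact (card X)"
  proof (rule card_permutes_symmetric_cases[OF X])
    show "\<exists>!k. k \<in> S \<times> T \<and> Q k \<tau>" if \<tau>: "\<tau> permutes X" for \<tau>
    proof -
      obtain a where a: "a \<in> S" "\<forall>s\<in>S. f (\<tau> a) \<le> f (\<tau> s)"
        "\<And>a'. a' \<in> S \<Longrightarrow> \<forall>s\<in>S. f (\<tau> a') \<le> f (\<tau> s) \<Longrightarrow> a' = a"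
        using ex1_argmin[OF fin(1) _ permutes_inj_on_comp[OF \<tau> S(1) f]] S(2) by blast
      obtain b where b: "b \<in> T" "\<forall>s\<in>T. g (\<tau> b) \<le> g (\<tau> s)"
        "\<And>b'. b' \<in> T \<Longrightarrow> \<forall>s\<in>T. g (\<tau> b') \<le> g (\<tau> s) \<Longrightarrow> b' = b"
        using ex1_argmin[OF fin(2) _ permutes_inj_on_comp[OF \<tau> T(1) g]] T(2) by blast
      show ?thesis
      proof (rule ex1I[of _ "(a, b)"])
        show "(a, b) \<in> S \<times> T \<and> Q (a, b) \<tau>"
          using a(1,2) b(1,2) by (simp add: Q_def)
        show "k = (a, b)" if "k \<in> S \<times> T \<and> Q k \<tau>" for k
          using that a(3)[of "fst k"] b(3)[of "snd k"] by (cases k) (simp add: Q_def)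
      qed
    qed
    show "\<exists>\<pi>. \<pi> permutes X \<and> (\<forall>\<tau>. \<tau> permutes X \<longrightarrow> Q k \<tau> \<longrightarrow> Q l (\<tau> \<circ> \<pi>))"
      if kl: "k \<in> S \<times> T" "l \<in> S \<times> T" for k l
    proof -
      obtain a b c d where eq: "k = (a, b)" "l = (c, d)" and in_S: "a \<in> S" "c \<in> S" and in_T: "b \<in> T" "d \<in> T"
        using kl by auto
      define \<pi> where "\<pi> = transpose a c \<circ> transpose b d"
      have "\<pi> permutes X"
        unfolding \<pi>_def using in_S in_T S T by (intro permutes_compose permutes_swap_id) auto
      moreover have "\<pi> c = a" "\<pi> d = b" "\<And>s. s \<in> S \<Longrightarrow> \<pi> s \<in> S" "\<And>t. t \<in> T \<Longrightarrow> \<pi> t \<in> T"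
        using in_S in_T disj by (auto simp: \<pi>_def transpose_def)
      ultimately show ?thesis
        unfolding eq by (intro exI[of _ \<pi>]) (auto simp: Q_def)
    qed
  qed (use fin S T in auto)
  then show ?thesis
    by (simp add: Q_def card_cartesian_product)
qed

text \<open>The set is a coset: its members are exactly \<open>\<rho>\<close> preceded by a
  permutation of \<open>A\<close> and one of \<open>B\<close>.\<close>

lemma card_permutes_two_blocks:
  assumes X: "finite X" and AB: "A \<subseteq> X" "B \<subseteq> X" "A \<inter> B = {}" and \<rho>: "\<rho> permutes X"
  shows "card {\<tau>. \<tau> permutes X \<and> \<tau> ` A = \<rho> ` A \<and> \<tau> ` B = \<rho> ` B \<and> (\<forall>x. x \<notin> A \<union> B \<longrightarrow> \<tau> x = \<rho> x)} =
    fact (card A) * fact (card B)"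
proof -
  let ?P = "{\<pi>. \<pi> permutes A} \<times> {\<pi>. \<pi> permutes B}"
  let ?h = "\<lambda>(p, q). \<rho> \<circ> (p \<circ> q)"
  have finAB: "finite A" "finite B" using AB X finite_subset by blast+
  have act: "(p \<circ> q) x = (if x \<in> A then p x else if x \<in> B then q x else x)"
    if p: "p permutes A" and q: "q permutes B" for p q x
  proof -
    have "q x \<notin> A" if "x \<in> B" using permutes_in_image[OF q] that AB(3) by blast
    then show ?thesis
      using permutes_not_in[OF p] permutes_not_in[OF q] AB(3) by (auto simp: disjoint_iff)
  qed
  have inj: "inj_on ?h ?P"
  proof (rule inj_onI, clarify)
    fix p q p' q'
    assume perm: "p permutes A" "q permutes B" "p' permutes A" "q' permutes B"
      and eq: "\<rho> \<circ> (p \<circ> q) = \<rho> \<circ> (p' \<circ> q')"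
    have pq: "(p \<circ> q) x = (p' \<circ> q') x" for x
      using fun_cong[OF eq, of x] permutes_inj[OF \<rho>] by (simp add: inj_eq)
    have "p x = p' x" for x
      using pq[of x] act[OF perm(1,2), of x] act[OF perm(3,4), of x]
        permutes_not_in[OF perm(1)] permutes_not_in[OF perm(3)] by (cases "x \<in> A") auto
    moreover have "q x = q' x" for x
    proof (cases "x \<in> B")
      case True
      then have "x \<notin> A" using AB(3) by blast
      with True show ?thesis
        using pq[of x] unfolding act[OF perm(1,2)] act[OF perm(3,4)] by simp
    next
      case False
      then show ?thesis
        using permutes_not_in[OF perm(2)] permutes_not_in[OF perm(4)] by simp
    qed
    ultimately show "p = p' \<and> q = q'" by blast
  qed
  have "{\<tau>. \<tau> permutes X \<and> \<tau> ` A = \<rho> ` A \<and> \<tau> ` B = \<rho> ` B \<and> (\<forall>x. x \<notin> A \<union> B \<longrightarrow> \<tau> x = \<rho> x)} = ?h ` ?P"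
  proof (intro equalityI subsetI)
    fix \<tau> assume "\<tau> \<in> {\<tau>. \<tau> permutes X \<and> \<tau> ` A = \<rho> ` A \<and> \<tau> ` B = \<rho> ` B \<and> (\<forall>x. x \<notin> A \<union> B \<longrightarrow> \<tau> x = \<rho> x)}"
    then have \<tau>: "\<tau> permutes X" "\<tau> ` A = \<rho> ` A" "\<tau> ` B = \<rho> ` B" "\<And>x. x \<notin> A \<union> B \<Longrightarrow> \<tau> x = \<rho> x" by auto
    define \<pi> where "\<pi> = inv \<rho> \<circ> \<tau>"
    have inv: "inv \<rho> (\<rho> x) = x" "\<rho> (inv \<rho> x) = x" for x
      using permutes_inverses[OF \<rho>] by auto
    have inj_\<pi>: "inj \<pi>"
      using permutes_compose[OF \<tau>(1) permutes_inv[OF \<rho>]] permutes_inj unfolding \<pi>_def by blast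
    have img: "\<pi> ` A = A" "\<pi> ` B = B"
      using \<tau>(2,3) inv(1) unfolding \<pi>_def image_comp[symmetric] by (simp_all add: image_image)
    have p: "restrict_id \<pi> A permutes A" and q: "restrict_id \<pi> B permutes B"
      using img inj_on_subset[OF inj_\<pi> subset_UNIV]
      by (simp_all add: permutes_restrict_id bij_betw_def)
    have "\<tau> x = (\<rho> \<circ> (restrict_id \<pi> A \<circ> restrict_id \<pi> B)) x" for x
    proof -
      have "(restrict_id \<pi> A \<circ> restrict_id \<pi> B) x = \<pi> x"
        unfolding act[OF p q] using \<tau>(4)[of x] inv(1) by (auto simp: \<pi>_def)
      then show ?thesis using inv(2) by (simp add: \<pi>_def)
    qed
    then have "\<tau> = \<rho> \<circ> (restrict_id \<pi> A \<circ> restrict_id \<pi> B)" by blast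
    then show "\<tau> \<in> ?h ` ?P"
      using p q by (intro image_eqI[of _ _ "(restrict_id \<pi> A, restrict_id \<pi> B)"]) auto
  next
    fix \<tau> assume "\<tau> \<in> ?h ` ?P"
    then obtain p q where pq: "p permutes A" "q permutes B" and \<tau>: "\<tau> = \<rho> \<circ> (p \<circ> q)" by auto
    have "\<tau> permutes X"
      unfolding \<tau> using permutes_subset[OF pq(1) AB(1)] permutes_subset[OF pq(2) AB(2)] \<rho>
      by (intro permutes_compose)
    moreover have "(p \<circ> q) ` A = p ` A" "(p \<circ> q) ` B = q ` B"
      using act[OF pq] AB(3) by (auto intro!: image_cong simp del: comp_apply simp: disjoint_iff)
    then have "\<tau> ` A = \<rho> ` A" "\<tau> ` B = \<rho> ` B"
      unfolding \<tau> image_comp[symmetric] permutes_image[OF pq(1)] permutes_image[OF pq(2)]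
      by (simp_all add: image_comp)
    moreover have "\<tau> x = \<rho> x" if "x \<notin> A \<union> B" for x
      using act[OF pq, of x] that by (simp add: \<tau>)
    ultimately show "\<tau> \<in> {\<tau>. \<tau> permutes X \<and> \<tau> ` A = \<rho> ` A \<and> \<tau> ` B = \<rho> ` B \<and> (\<forall>x. x \<notin> A \<union> B \<longrightarrow> \<tau> x = \<rho> x)}"
      by simp
  qed
  then show ?thesis
    using card_image[OF inj] finAB card_permutations[OF refl finAB(1)] card_permutations[OF refl finAB(2)]
    by (simp add: card_cartesian_product)
qed

section \<open>The permutation \<open>s\<^sub>i w\<^sub>0\<close>\<close>

lemma Set_System_eq_lpm: "ground M = {1..n} \<Longrightarrow> bases M = Bs \<Longrightarrow> M = Set_System {1..n} Bs"
  by (simp add: set_system.expand)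

lemma lpm_top:
  assumes "U \<subseteq> {1..n}" "card U = k" "k \<le> n"
  shows "lpm n U {n+1-k..n} = Set_System {1..n} (dominated n U)"
  by (rule Set_System_eq_lpm) (use bases_lpm_top(1)[OF assms] in simp_all)

lemma lpm_bumped:
  assumes "U \<subseteq> {1..n}" "card U = n - i" "1 \<le> i" "i < n"
  shows "lpm n U (insert i {i+2..n}) = Set_System {1..n} (dominated n U - {{i+1..n}})"
  by (rule Set_System_eq_lpm) (use bases_lpm_bumped(1)[OF assms] in simp_all)

lemma w0_permutes: "w0 n permutes {1..n}"
  by (rule bij_imp_permutes, rule bij_betw_byWitness[where f' = "w0 n"]) (auto simp: w0_def)

lemma w0_image_prefix:
  assumes "k \<le> n"
  shows "w0 n ` {1..k} = {n+1-k..n}"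
proof (intro equalityI subsetI)
  fix x assume "x \<in> {n+1-k..n}"
  then show "x \<in> w0 n ` {1..k}"
    using assms by (intro image_eqI[of _ _ "n + 1 - x"]) (auto simp: w0_def)
qed (use assms in \<open>auto simp: w0_def\<close>)

lemma siw0_permutes:
  assumes "1 \<le> i" "i < n"
  shows "transpose i (i + 1) \<circ> w0 n permutes {1..n}"
  using assms by (intro permutes_compose[OF w0_permutes] permutes_swap_id) auto

text \<open>Exchanging \<open>i\<close> and \<open>i + 1\<close> changes a final segment of values
  only if it separates the two, that is, if it starts at \<open>i + 1\<close>.\<close>

lemma siw0_image_prefix:
  assumes "1 \<le> i" "i < n" "k \<le> n"
  shows "(transpose i (i + 1) \<circ> w0 n) ` {1..k} = (if k = n - i then insert i {i+2..n} else {n+1-k..n})"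
proof -
  have "(transpose i (i + 1) \<circ> w0 n) ` {1..k} = transpose i (i + 1) ` {n+1-k..n}"
    by (simp only: image_comp[symmetric] w0_image_prefix[OF assms(3)])
  also have "\<dots> = (if k = n - i then insert i {i+2..n} else {n+1-k..n})"
  proof (cases "k = n - i")
    case True
    then have "{n+1-k..n} = insert (i+1) {i+2..n}" using assms by auto
    then show ?thesis using True by (auto simp: transpose_def)
  next
    case False
    then have "i \<in> {n+1-k..n} \<longleftrightarrow> i + 1 \<in> {n+1-k..n}" using assms by auto
    then show ?thesis using False by (subst transpose_image_eq) auto
  qed
  finally show ?thesis .
qed

text \<open>In the decreasing sequence the exchanged values \<open>i + 1\<close>, \<open>i\<close>
  stand at positions \<open>n - i\<close> and \<open>n - i + 1\<close>; no other neighbours change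
  their order.\<close>

lemma siw0_ascent_iff:
  assumes "1 \<le> i" "i < n" "1 \<le> j" "j < n"
  shows "(transpose i (i + 1) \<circ> w0 n) j < (transpose i (i + 1) \<circ> w0 n) (Suc j) \<longleftrightarrow> j = n - i"
  using assms by (auto simp: w0_def transpose_def split: if_splits)

text \<open>Both coordinates can rise only at the single ascent of the first. The weak inequality is
  strict for a permutation and matches the form of the extremal events counted later.\<close>

lemma falling_siw0_iff:
  assumes "1 \<le> i" "i < n"
  shows "falling (C_pair n (transpose i (i + 1) \<circ> w0 n) \<tau>) \<longleftrightarrow> \<tau> (n - i + 1) \<le> \<tau> (n - i)"
proof
  assume fall: "falling (C_pair n (transpose i (i + 1) \<circ> w0 n) \<tau>)"
  define k where "k = n - i - 1"
  have k: "Suc k = n - i" "k + 1 < n" "k < n" using assms by (auto simp: k_def)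
  then show "\<tau> (n - i + 1) \<le> \<tau> (n - i)"
    using fall[unfolded falling_def, rule_format, of k] siw0_ascent_iff[OF assms, of "Suc k"] 
    by (simp add: C_pair_nth del: comp_apply)
next
  assume desc: "\<tau> (n - i + 1) \<le> \<tau> (n - i)"
  show "falling (C_pair n (transpose i (i + 1) \<circ> w0 n) \<tau>)"
    unfolding falling_def
  proof (intro allI impI)
    fix k assume "k + 1 < length (C_pair n (transpose i (i + 1) \<circ> w0 n) \<tau>)"
    then have k: "k + 1 < n" "k < n" by simp_all
    then show "\<not> (fst (C_pair n (transpose i (i + 1) \<circ> w0 n) \<tau> ! k) < fst (C_pair n (transpose i (i + 1) \<circ> w0 n) \<tau> ! (k + 1)) \<and>
        snd (C_pair n (transpose i (i + 1) \<circ> w0 n) \<tau> ! k) < snd (C_pair n (transpose i (i + 1) \<circ> w0 n) \<tau> ! (k + 1)))"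
      using siw0_ascent_iff[OF assms, of "Suc k"] desc
      by (auto simp add: C_pair_nth simp del: comp_apply)
  qed
qed

lemma siw0_label_sequence_iff:
  assumes i: "1 \<le> i" "i < n" and \<tau>: "\<tau> permutes {1..n}"
  shows "(\<exists>Ms. maximal_chain n Ms \<and> label_sequence n Ms (C_pair n (transpose i (i + 1) \<circ> w0 n) \<tau>)) \<longleftrightarrow>
    (\<exists>q\<in>{n-i+1..n}. \<tau> (n - i) < \<tau> q) \<and> (\<exists>c\<in>{1..n-i+1}. \<tau> c < \<tau> (n - i + 1))"
proof -
  define \<sigma> where "\<sigma> = transpose i (i + 1) \<circ> w0 n"
  define m where "m = n - i"
  have m: "1 \<le> m" "m < n" using i by (auto simp: m_def)
  define U where "U k = \<tau> ` {1..k}" for k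
  have U: "U k \<subseteq> {1..n}" if "k \<le> n" for k
    using image_mono[of "{1..k}" "{1..n}" \<tau>] permutes_image[OF \<tau>] that by (simp add: U_def)
  have cardU: "card (U k) = k" for k
    using permutes_inj[OF \<tau>] by (simp add: U_def card_image inj_on_subset)
  have L: "\<sigma> ` {1..k} = (if k = m then insert i {i+2..n} else {n+1-k..n})" if "k \<le> n" for k
    using siw0_image_prefix[OF i that] by (simp only: \<sigma>_def m_def)
  have mem: "\<tau> (Suc k) \<in> U (Suc k)" and rem: "U (Suc k) - {\<tau> (Suc k)} = U k" if "k < n" for k
    using image_permutes_Suc[OF \<tau> that] by (auto simp: U_def)
  have top: "lpm n (U k) (\<sigma> ` {1..k}) = Set_System {1..n} (dominated n (U k))" 
      "(U k, \<sigma> ` {1..k}) \<in> path_pairs n" if "k \<le> n" "k \<noteq> m" for k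
    using lpm_top[OF U[OF that(1)] cardU that(1)] bases_lpm_top(2)[OF U[OF that(1)] cardU that(1)]
      L[OF that(1)] that(2) by (simp_all only: if_False)
  have bumped: "lpm n (U m) (\<sigma> ` {1..m}) = Set_System {1..n} (dominated n (U m) - {{i+1..n}})"
      "(U m, \<sigma> ` {1..m}) \<in> path_pairs n \<longleftrightarrow> U m \<noteq> {i+1..n}"
    using lpm_bumped[OF U _ i, of m] bases_lpm_bumped(2)[OF U _ i, of m] L[of m] m cardU[of m]
    by (simp_all only: m_def[symmetric] if_True less_imp_le simp_thms)
  define Step where "Step k \<longleftrightarrow> (U (Suc k), \<sigma> ` {1..Suc k}) \<in> path_pairs n \<and>
       quotient_le (lpm n (U k) (\<sigma> ` {1..k})) (lpm n (U (Suc k)) (\<sigma> ` {1..Suc k}))" for k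
  have generic: "Step k" if "k < n" "k \<noteq> m" "Suc k \<noteq> m" for k
    using top[of k] top[of "Suc k"] quotient_le_dominated[OF U[of "Suc k"] mem[OF that(1)]] 
      rem[OF that(1)] that unfolding Step_def by simp
  \<comment> \<open>\<open>Step k\<close> leads from rank \<open>k\<close> to \<open>k + 1\<close>,
    so the exceptional path is entered by \<open>Step m'\<close> and left by
    \<open>Step m\<close>.\<close>
  obtain m' where m': "m = Suc m'" using m by (cases m) auto
  have step_m: "Step m' \<longleftrightarrow> (\<exists>q\<in>{m+1..n}. \<tau> m < \<tau> q)"
  proof -
    have gap: "(\<exists>w. \<tau> m < w \<and> w \<le> n \<and> w \<notin> U m) \<longleftrightarrow> (\<exists>q\<in>{m+1..n}. \<tau> m < \<tau> q)"
    proof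
      assume "\<exists>w. \<tau> m < w \<and> w \<le> n \<and> w \<notin> U m"
      then obtain w where w: "\<tau> m < w" "w \<le> n" "w \<notin> U m" by blast
      then have "w \<in> \<tau> ` {1..n}" using permutes_image[OF \<tau>] by auto
      then obtain q where "q \<in> {1..n}" "w = \<tau> q" by blast
      with w show "\<exists>q\<in>{m+1..n}. \<tau> m < \<tau> q"
        by (intro bexI[of _ q]) (auto simp: U_def Suc_le_eq)
    next
      assume "\<exists>q\<in>{m+1..n}. \<tau> m < \<tau> q"
      then obtain q where q: "q \<in> {m+1..n}" "\<tau> m < \<tau> q" by blast
      have "\<tau> q \<notin> U m"
        using q permutes_inj[OF \<tau>] by (auto simp: U_def inj_image_mem_iff)
      moreover have "\<tau> q \<in> {1..n}" using permutes_in_image[OF \<tau>, of q] q by simp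
      ultimately show "\<exists>w. \<tau> m < w \<and> w \<le> n \<and> w \<notin> U m" using q by auto
    qed
    have am: "\<tau> m \<in> U m" "U m - {\<tau> m} = U m'" using mem[of m'] rem[of m'] m m' by simp_all
    have "Step m' \<longleftrightarrow> U m \<noteq> {i+1..n} \<and> (\<exists>w. \<tau> m < w \<and> w \<le> n \<and> w \<notin> U m)"
      using quotient_le_remove_suffix_iff[OF U[of m] am(1) i(2)] bumped top(1)[of m'] m cardU[of m] am(2)
      unfolding Step_def m'[symmetric] by (auto simp: m_def[symmetric] m' simp del: One_nat_def)
    \<comment> \<open>If \<open>U m\<close> were \<open>{i+1..n}\<close>, it would contain every
      value above its member \<open>\<tau> m\<close>; the gap already excludes this.\<close>
    also have "\<dots> \<longleftrightarrow> (\<exists>w. \<tau> m < w \<and> w \<le> n \<and> w \<notin> U m)"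
      using am(1) by auto
    finally show ?thesis unfolding gap .
  qed
  \<comment> \<open>The first condition is assumed because it ensures
    \<open>U m \<noteq> {i+1..n}\<close>, without which the exceptional matroid would have no valid
    pair of paths.\<close>
  have step_Sm: "(\<exists>q\<in>{m+1..n}. \<tau> m < \<tau> q) \<Longrightarrow> Step m \<longleftrightarrow> (\<exists>c\<in>{1..m+1}. \<tau> c < \<tau> (m + 1))"
  proof -
    assume "\<exists>q\<in>{m+1..n}. \<tau> m < \<tau> q"
    then have "Step m'" using step_m by blast
    then have ne: "U m \<noteq> {i+1..n}" using bumped(2) by (simp add: Step_def m')
    have "Step m \<longleftrightarrow> (\<exists>c\<in>U (Suc m). c < \<tau> (Suc m))"
      using quotient_le_from_removed_suffix_iff[OF U[of "Suc m"] mem[OF m(2)] i] 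
        bumped(1) top[of "Suc m"] m cardU[of "Suc m"] rem[OF m(2)] ne
      unfolding Step_def by (simp add: m_def[symmetric])
    then show ?thesis by (simp add: U_def)
  qed
  have "(\<forall>k<n. Step k) \<longleftrightarrow> Step m' \<and> Step m"
    using generic m m' by (metis Suc_inject Suc_lessD)
  also have "\<dots> \<longleftrightarrow> (\<exists>q\<in>{m+1..n}. \<tau> m < \<tau> q) \<and> (\<exists>c\<in>{1..m+1}. \<tau> c < \<tau> (m + 1))"
    using step_m step_Sm by blast
  finally show ?thesis
    using C_pair_label_sequence_iff[OF \<tau> siw0_permutes[OF i]]
    unfolding Step_def U_def \<sigma>_def m_def by simp
qed

section \<open>Counting the admissible permutations\<close>

lemma inj_on_C_pair: "inj_on (C_pair n \<sigma>) {\<tau>. \<tau> permutes {1..n}}"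
proof (rule inj_onI, clarify)
  fix \<tau> \<tau>' assume perm: "\<tau> permutes {1..n}" "\<tau>' permutes {1..n}" and eq: "C_pair n \<sigma> \<tau> = C_pair n \<sigma> \<tau>'"
  have "\<tau> x = \<tau>' x" for x
  proof (cases "x \<in> {1..n}")
    case True
    then have "x - 1 < n" "Suc (x - 1) = x" by auto
    then show ?thesis
      using arg_cong[OF eq, of "\<lambda>ps. ps ! (x - 1)"] by (simp add: C_pair_nth)
  next
    case False
    then show ?thesis using permutes_not_in perm by metis
  qed
  then show "\<tau> = \<tau>'" by blast
qed

lemma card_C_set_siw0:
  assumes "1 \<le> i" "i < n"
  shows "card (C_set n (transpose i (i + 1) \<circ> w0 n)) = card {\<tau>. \<tau> permutes {1..n} \<and> 
    \<tau> (n - i + 1) \<le> \<tau> (n - i) \<and> 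
    (\<exists>q\<in>{n-i+1..n}. \<tau> (n - i) < \<tau> q) \<and> (\<exists>c\<in>{1..n-i+1}. \<tau> c < \<tau> (n - i + 1))}" (is "_ = card ?V")
proof -
  have "C_set n (transpose i (i + 1) \<circ> w0 n) = C_pair n (transpose i (i + 1) \<circ> w0 n) ` ?V"
    using siw0_label_sequence_iff[OF assms] falling_siw0_iff[OF assms]
    unfolding C_set_def by blast
  moreover have "inj_on (C_pair n (transpose i (i + 1) \<circ> w0 n)) ?V"
    by (rule inj_on_subset[OF inj_on_C_pair]) blast
  ultimately show ?thesis by (simp add: card_image)
qed

text \<open>The inequalities force \<open>\<tau>\<close> to map the four position blocks onto consecutive value blocks.\<close>

lemma card_permutes_four_blocks:
  assumes "1 \<le> m" "m < n"
  shows "card {\<tau>. \<tau> permutes {1..n} \<and> (\<forall>q\<in>{m+2..n}. \<tau> q < \<tau> m) \<and> \<tau> m < \<tau> (m+1) \<and>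
      (\<forall>p\<in>{1..<m}. \<tau> (m+1) < \<tau> p)} = fact (m - 1) * fact (n - m - 1)" (is "card ?K = _")
proof -
  define i where "i = n - m"
  have i: "1 \<le> i" "i < n" "n - i = m" using assms by (auto simp: i_def)
  define \<sigma> where "\<sigma> = transpose i (i + 1) \<circ> w0 n"
  have \<sigma>: "\<sigma> permutes {1..n}"
    unfolding \<sigma>_def by (rule siw0_permutes[OF i(1,2)])
  let ?A = "{1..<m}" and ?D = "{m+2..n}"
  have vals: "\<tau> ` ?D = {1..<i} \<and> \<tau> m = i \<and> \<tau> (m+1) = i + 1 \<and> \<tau> ` ?A = {i+1<..n}" if "\<tau> \<in> ?K" for \<tau>
  proof -
    from that have perm: "\<tau> permutes {1..n}" and D: "\<And>q. q \<in> ?D \<Longrightarrow> \<tau> q < \<tau> m" 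
      and mid: "\<tau> m < \<tau> (m+1)" and A: "\<And>p. p \<in> ?A \<Longrightarrow> \<tau> (m+1) < \<tau> p" by auto
    have cover: "\<exists>j. w = \<tau> j \<and> (j \<in> ?A \<or> j = m \<or> j = m + 1 \<or> j \<in> ?D)" if "w \<in> {1..n}" for w
    proof -
      have "w \<in> \<tau> ` {1..n}" using that permutes_image[OF perm] by simp
      then obtain j where "j \<in> {1..n}" "w = \<tau> j" by blast
      then show ?thesis by (intro exI[of _ j]) auto
    qed
    have into: "\<tau> j \<in> {1..n}" if "j \<in> {1..n}" for j
      using that by (simp only: permutes_in_image[OF perm])
    have inj: "inj_on \<tau> S" for S using permutes_inj_on[OF perm] .
    have imD: "\<tau> ` ?D = {1..<\<tau> m}"
    proof (intro equalityI subsetI)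
      fix w assume w: "w \<in> {1..<\<tau> m}"
      have "\<tau> m \<le> n" using into[of m] assms by simp
      with w obtain j where j: "w = \<tau> j" "j \<in> ?A \<or> j = m \<or> j = m + 1 \<or> j \<in> ?D"
        using cover[of w] by auto
      have "j \<notin> ?A" "j \<noteq> m" "j \<noteq> m + 1" using w mid A[of j] unfolding j(1) by auto
      with j show "w \<in> \<tau> ` ?D" by blast
    next
      fix w assume "w \<in> \<tau> ` ?D"
      then obtain q where q: "q \<in> ?D" "w = \<tau> q" by blast
      then show "w \<in> {1..<\<tau> m}" using D[of q] into[of q] by simp
    qed
    have imA: "\<tau> ` ?A = {\<tau> (m+1)<..n}"
    proof (intro equalityI subsetI)
      fix w assume w: "w \<in> {\<tau> (m+1)<..n}"
      then obtain j where j: "w = \<tau> j" "j \<in> ?A \<or> j = m \<or> j = m + 1 \<or> j \<in> ?D"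
        using cover[of w] by auto
      have "j \<notin> ?D" "j \<noteq> m" "j \<noteq> m + 1" using w mid D[of j] unfolding j(1) by auto
      with j show "w \<in> \<tau> ` ?A" by blast
    next
      fix w assume "w \<in> \<tau> ` ?A"
      then obtain p where p: "p \<in> ?A" "w = \<tau> p" by blast
      then show "w \<in> {\<tau> (m+1)<..n}" using A[of p] into[of p] assms by simp
    qed
    \<comment> \<open>The sizes of the outer blocks fix the two middle values.\<close>
    have "card (\<tau> ` ?D) = card ?D" "card (\<tau> ` ?A) = card ?A"
      by (rule card_image[OF inj])+
    then have "\<tau> m - 1 = i - 1" "n - \<tau> (m+1) = m - 1"
      unfolding imD imA using assms by (simp_all add: i_def)
    moreover have "1 \<le> \<tau> m" "\<tau> (m+1) \<le> n" using into[of m] into[of "m+1"] assms by simp_all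
    ultimately have "\<tau> m = i" "\<tau> (m+1) = i + 1"
      using i assms by linarith+
    then show ?thesis using imD imA by simp
  qed
  \<comment> \<open>\<open>\<sigma>\<close> itself satisfies the inequalities and serves as the base
    point of the coset.\<close>
  have \<sigma>K: "\<sigma> \<in> ?K"
    using \<sigma> assms by (auto simp: \<sigma>_def i_def w0_def transpose_def)
  have eq: "?K = {\<tau>. \<tau> permutes {1..n} \<and> \<tau> ` ?A = \<sigma> ` ?A \<and> \<tau> ` ?D = \<sigma> ` ?D \<and> 
      (\<forall>x. x \<notin> ?A \<union> ?D \<longrightarrow> \<tau> x = \<sigma> x)}"
  proof (intro equalityI subsetI)
    fix \<tau> assume K: "\<tau> \<in> ?K"
    have "\<tau> x = \<sigma> x" if x: "x \<notin> ?A \<union> ?D" for x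
    proof (cases "x \<in> {1..n}")
      case True
      then have "x = m \<or> x = m + 1" using x by auto
      then show ?thesis using vals[OF K] vals[OF \<sigma>K] by auto
    next
      case False
      have "\<tau> permutes {1..n}" using K by blast
      then show ?thesis using False \<sigma> permutes_not_in by metis
    qed
    then show "\<tau> \<in> {\<tau>. \<tau> permutes {1..n} \<and> \<tau> ` ?A = \<sigma> ` ?A \<and> \<tau> ` ?D = \<sigma> ` ?D \<and> 
      (\<forall>x. x \<notin> ?A \<union> ?D \<longrightarrow> \<tau> x = \<sigma> x)}"
      using K vals[OF K] vals[OF \<sigma>K] by simp
  next
    fix \<tau> assume "\<tau> \<in> {\<tau>. \<tau> permutes {1..n} \<and> \<tau> ` ?A = \<sigma> ` ?A \<and> \<tau> ` ?D = \<sigma> ` ?D \<and> 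
      (\<forall>x. x \<notin> ?A \<union> ?D \<longrightarrow> \<tau> x = \<sigma> x)}"
    then have \<tau>: "\<tau> permutes {1..n}" "\<tau> ` ?A = {i+1<..n}" "\<tau> ` ?D = {1..<i}" "\<tau> m = i" "\<tau> (m+1) = i + 1"
      using vals[OF \<sigma>K] by auto
    have "\<tau> q < i" if "q \<in> ?D" for q
      using imageI[OF that, of \<tau>] unfolding \<tau>(3) by simp
    moreover have "i + 1 < \<tau> p" if "p \<in> ?A" for p
      using imageI[OF that, of \<tau>] unfolding \<tau>(2) by simp
    ultimately show "\<tau> \<in> ?K" using \<tau>(1,4,5) by simp
  qed
  show ?thesis
    unfolding eq using assms
    by (subst card_permutes_two_blocks[OF _ _ _ _ \<sigma>]) auto
qed

theorem theorem3p18: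
  fixes n i :: nat
  assumes "n \<ge> 3" and "2 \<le> i" and "i \<le> n - 1"
  shows "real (card (C_set n (transpose i (i + 1) \<circ> w0 n))) =
      fact n / ((real n - real i) * (real n - real i + 1))
    + fact n / (real i * (real i + 1))
    + fact n / (real i * (real n - real i))
    + fact n / 2
    - fact n / real i
    - fact n / (real n - real i)
    - fact (i - 1) * fact (n - 1 - i)"
proof -
  define m where "m = n - i"
  have m: "1 \<le> m" "m + 1 \<le> n" "n = m + i" using assms by (auto simp: m_def)
  let ?X = "{1..n}"
  define G where "G = {\<tau>. \<tau> permutes ?X \<and> \<tau> (m+1) \<le> \<tau> m}"
  define F1 where "F1 = {\<tau>. \<tau> permutes ?X \<and> (\<forall>s\<in>{1..m+1}. \<tau> (m+1) \<le> \<tau> s)}"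
  define F2 where "F2 = {\<tau>. \<tau> permutes ?X \<and> (\<forall>s\<in>{m..n}. \<tau> s \<le> \<tau> m)}"
  \<comment> \<open>\<open>J\<close> is \<open>F1 \<inter> F2\<close> without the comparison of
    positions \<open>m\<close> and \<open>m+1\<close>. The position sets become disjoint, of sizes
    \<open>m\<close> and \<open>i\<close>, so \<open>J\<close> can be counted by symmetry.\<close>
  define J where "J = {\<tau>. \<tau> permutes ?X \<and> (\<forall>s\<in>insert (m+1) {1..<m}. \<tau> (m+1) \<le> \<tau> s) \<and>
    (\<forall>s\<in>insert m {m+2..n}. \<tau> s \<le> \<tau> m)}"
  define K where "K = {\<tau>. \<tau> permutes ?X \<and> (\<forall>q\<in>{m+2..n}. \<tau> q < \<tau> m) \<and> \<tau> m < \<tau> (m+1) \<and>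
      (\<forall>p\<in>{1..<m}. \<tau> (m+1) < \<tau> p)}"
  have fin: "finite {\<tau>. \<tau> permutes ?X \<and> P \<tau>}" for P
    using finite_permutations[of ?X] by (rule rev_finite_subset) auto
  note fins = fin[where P = "\<lambda>\<tau>. \<tau> (m+1) \<le> \<tau> m", folded G_def]
    fin[where P = "\<lambda>\<tau>. \<forall>s\<in>{1..m+1}. \<tau> (m+1) \<le> \<tau> s", folded F1_def]
    fin[where P = "\<lambda>\<tau>. \<forall>s\<in>{m..n}. \<tau> s \<le> \<tau> m", folded F2_def]
  have finJ: "finite J" unfolding J_def by (rule fin)
  have inj_id: "inj_on (\<lambda>x. x) ?X" and inj_neg: "inj_on (\<lambda>x. - int x) ?X"
    by (auto intro: inj_onI)
  have "G = {\<tau>. \<tau> permutes ?X \<and> (\<forall>s\<in>{m, m+1}. \<tau> (m+1) \<le> \<tau> s)}"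
    by (auto simp: G_def)
  then have cG: "card G * 2 = fact n"
    using card_permutes_argmin[of ?X "{m, m+1}" "m+1", OF _ _ _ inj_id] m by simp
  have cF1: "card F1 * (m + 1) = fact n"
    using card_permutes_argmin[of ?X "{1..m+1}" "m+1", OF _ _ _ inj_id] m by (simp add: F1_def)
  have cF2: "card F2 * (i + 1) = fact n"
    using card_permutes_argmin[of ?X "{m..n}" m, OF _ _ _ inj_neg] m by (simp add: F2_def)
  have "{1..<m} \<subseteq> ?X" "{1..<m} \<inter> {m+2..n} = {}"
    using m by auto
  then have cJ: "card J * (m * i) = fact n"
    using card_permutes_argmin2[of ?X "insert (m+1) {1..<m}" "m+1" "insert m {m+2..n}" m, OF _ _ _ _ _ _ inj_id inj_neg] m assms
    by (simp add: J_def)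
  have cK: "card K = fact (m - 1) * fact (i - 1)"
    using card_permutes_four_blocks[of m n] m by (simp add: K_def)
  have KJ: "K \<subseteq> J"
    by (auto simp: K_def J_def)
  \<comment> \<open>Splits the counts of \<open>F1\<close> and \<open>F2\<close> into the pairs of
    terms in which the formula is stated.\<close>
  have partial_fractions: "x / (y + 1) = x / y - x / (y * (y + 1))" if "y > 0" for x y :: real
    using that by (simp add: divide_simps) (simp add: algebra_simps)?
  \<comment> \<open>If a member of \<open>J\<close> has \<open>\<tau> m < \<tau> (m+1)\<close>, its
    inequalities link up to those of \<open>K\<close>; otherwise the dropped comparison holds and
    both extremal conditions are complete.\<close>
  have F12: "F1 \<inter> F2 = J - K"
  proof (intro equalityI subsetI)
    fix \<tau> assume "\<tau> \<in> F1 \<inter> F2"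
    moreover from this have "\<tau> (m+1) \<le> \<tau> m" using m by (simp add: F1_def)
    then have "\<tau> \<notin> K" by (simp add: K_def)
    ultimately show "\<tau> \<in> J - K" using m by (simp add: F1_def F2_def J_def)
  next
    fix \<tau> assume \<tau>: "\<tau> \<in> J - K"
    then have perm: "\<tau> permutes ?X" and 1: "\<And>s. s \<in> {1..<m} \<Longrightarrow> \<tau> (m+1) \<le> \<tau> s" 
      and 2: "\<And>s. s \<in> {m+2..n} \<Longrightarrow> \<tau> s \<le> \<tau> m" by (auto simp: J_def)
    have neq: "\<tau> a \<noteq> \<tau> b" if "a \<noteq> b" for a b
      using permutes_inj[OF perm] that by (auto dest: injD)
    have le: "\<tau> (m+1) \<le> \<tau> m"
    proof (rule ccontr)
      assume "\<not> ?thesis"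
      moreover have "\<tau> q < \<tau> m" if "q \<in> {m+2..n}" for q
        using 2[OF that] neq[of q m] that by (cases "q = m") auto
      moreover have "\<tau> (m+1) < \<tau> p" if "p \<in> {1..<m}" for p
        using 1[OF that] neq[of "m+1" p] that by (cases "m + 1 = p") auto
      ultimately have "\<tau> \<in> K" using perm by (simp add: K_def)
      then show False using \<tau> by simp
    qed
    have "\<tau> (m+1) \<le> \<tau> s" if "s \<in> {1..m+1}" for s
      using 1[of s] le that by (cases "s = m + 1"; cases "s = m") auto
    moreover have "\<tau> s \<le> \<tau> m" if "s \<in> {m..n}" for s
      using 2[of s] le that by (cases "s = m + 1"; cases "s = m") auto
    ultimately show "\<tau> \<in> F1 \<inter> F2" using perm by (simp add: F1_def F2_def)
  qed
  \<comment> \<open>Both position ranges contain \<open>m\<close> and \<open>m+1\<close>, so either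
    failure already implies the descent.\<close>
  have sub: "F1 \<union> F2 \<subseteq> G"
    using m by (auto simp: F1_def F2_def G_def)
  have "{\<tau>. \<tau> permutes ?X \<and> \<tau> (m+1) \<le> \<tau> m \<and> 
      (\<exists>q\<in>{m+1..n}. \<tau> m < \<tau> q) \<and> (\<exists>c\<in>{1..m+1}. \<tau> c < \<tau> (m+1))} = G - (F1 \<union> F2)"
  proof -
    have last: "(\<exists>q\<in>{m+1..n}. \<tau> m < \<tau> q) \<longleftrightarrow> \<not> (\<forall>s\<in>{m..n}. \<tau> s \<le> \<tau> m)" for \<tau> :: "nat \<Rightarrow> nat"
    proof -
      have "{m..n} = insert m {m+1..n}" using m by auto
      then show ?thesis by (auto simp: not_le)
    qed
    have first: "(\<exists>c\<in>{1..m+1}. \<tau> c < \<tau> (m+1)) \<longleftrightarrow> \<not> (\<forall>s\<in>{1..m+1}. \<tau> (m+1) \<le> \<tau> s)" for \<tau> :: "nat \<Rightarrow> nat"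
      by (simp only: not_le ball_simps bex_simps)
    have "{\<tau>. P \<tau> \<and> Q \<tau> \<and> \<not> A \<tau> \<and> \<not> B \<tau>} = {\<tau>. P \<tau> \<and> Q \<tau>} - ({\<tau>. P \<tau> \<and> B \<tau>} \<union> {\<tau>. P \<tau> \<and> A \<tau>})"
      for P Q A B :: "(nat \<Rightarrow> nat) \<Rightarrow> bool"
      by blast
    then show ?thesis unfolding last first G_def F1_def F2_def .
  qed
  then have "card (C_set n (transpose i (i + 1) \<circ> w0 n)) = card (G - (F1 \<union> F2))"
    using card_C_set_siw0[of i n] assms by (simp add: m_def)
  also have "\<dots> = card G - card (F1 \<union> F2)"
    using sub fins by (intro card_Diff_subset) auto
  finally have "real (card (C_set n (transpose i (i + 1) \<circ> w0 n))) = real (card G) - real (card (F1 \<union> F2))"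
    using card_mono[OF fins(1) sub] by simp
  moreover have "card F1 + card F2 = card (F1 \<union> F2) + card (F1 \<inter> F2)"
    using fins by (intro card_Un_Int)
  moreover have "card (F1 \<inter> F2) + card K = card J"
    unfolding F12 using card_Diff_subset[OF finite_subset[OF KJ finJ] KJ] card_mono[OF finJ KJ] by simp
  ultimately have "real (card (C_set n (transpose i (i + 1) \<circ> w0 n))) =
      real (card G) - real (card F1) - real (card F2) + real (card J) - real (card K)"
    by linarith
  also have "real (card G) = fact n / 2"
    using arg_cong[OF cG, of real] by simp
  also have "real (card F1) = fact n / real (m + 1)"
    using arg_cong[OF cF1, of real] by (simp add: field_simps)
  also have "real (card F2) = fact n / real (i + 1)"
    using arg_cong[OF cF2, of real] by (simp add: field_simps)
  also have "real (card J) = fact n / (real m * real i)"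
    using arg_cong[OF cJ, of real] m assms by (simp add: field_simps)
  also have "real (card K) = fact (i - 1) * fact (m - 1)"
    using arg_cong[OF cK, of real] by simp
  also have "fact n / real (m + 1) = fact n / real m - fact n / (real m * (real m + 1))"
    using partial_fractions[of "real m"] m by (simp add: add.commute)
  also have "fact n / real (i + 1) = fact n / real i - fact n / (real i * (real i + 1))"
    using partial_fractions[of "real i"] assms by (simp add: add.commute)
  finally have "real (card (C_set n (transpose i (i + 1) \<circ> w0 n))) =
      fact n / 2 - (fact n / real m - fact n / (real m * (real m + 1))) -
      (fact n / real i - fact n / (real i * (real i + 1))) + fact n / (real m * real i) -
      fact (i - 1) * fact (m - 1)" .
  moreover have "real n - real i = real m" "n - 1 - i = m - 1" using m by simp_all
  ultimately show ?thesis by (simp add: mult.commute)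
qed

end
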